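(* Let $\Gamma$ be an infinite finitely generated group, let $G$ be a Cayley graph of $\Gamma$ with respect to a finite symmetric generating set not containing the identity, and let $o$ be a vertex of $G$. Then $$\mathbf E_{\mathrm{FSF}}[\deg_{\mathfrak F}o]=2\beta_1(\Gamma)+2 .$$
   Context: The Cayley graph has undirected edges $[\gamma,\gamma s]$, $\gamma\in\Gamma$, $s$ in the generating set; each edge is given an arbitrary orientation in order to define chains. $C_1(G)$ is the space of finitely supported complex 1-chains, a subspace of $C_1^{(2)}(G)=\ell^2(\text{edges of }G)$; $\partial_1$ is the boundary map, $\delta_0=\partial_1^*$ the coboundary map; $Z_1(G)=\{u\in C_1(G):\partial_1u=0\}$ is the space of finite cycles, and $B^1_{(2)}(G)=\delta_0\big(\ell^2(\Gamma)\big)$. Orthogonal complements are taken in $C_1^{(2)}(G)$. The free uniform spanning forest measure $\mathrm{FSF}$ is the determinantal probability measure on sets of edges of $G$ corresponding to the closed subspace $Z_1(G)^\perp$; i.e., if $Q$ is the matrix of the orthogonal projection onto $Z_1(G)^\perp$, then the random edge set $\mathfrak F$ satisfies $\mathrm{FSF}[D\subseteq\mathfrak F]=\det[Q]_{D,D}$ for all finite sets $D$ of edges. $\mathbf E_{\mathrm{FSF}}$ is the corresponding expectation, and $\deg_{\mathfrak F}o$ is the number of edges of $\mathfrak F$ incident to $o$. $\beta_1(\Gamma)$ is the first $\ell^2$-Betti number of $\Gamma$; equivalently, $\beta_1(\Gamma)=\dim_\Gamma\big(B^1_{(2)}(G)^\perp\cap Z_1(G)^\perp\big)$, where $\dim_\Gamma$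 is von Neumann dimension with respect to $\Gamma$. *)

theory Defs
  imports
    "HOL-Probability.Probability"
    "HOL-Algebra.Generated_Groups"
    "Graph_Theory.Digraph"
    "Jordan_Normal_Form.Determinant"
begin

section \<open>The Hilbert space of square-summable functions on a set\<close>

text \<open>Elements are functions on the ambient type that vanish outside the index set, so that
  equality in the Hilbert space is equality of functions.\<close>

definition l2 :: "'i set \<Rightarrow> ('i \<Rightarrow> complex) set" where
  "l2 I = {u. (\<forall>i. i \<notin> I \<longrightarrow> u i = 0) \<and> (\<lambda>i. (cmod (u i))\<^sup>2) summable_on I}"

definition l2_inner :: "'i set \<Rightarrow> ('i \<Rightarrow> complex) \<Rightarrow> ('i \<Rightarrow> complex) \<Rightarrow> complex" where
  "l2_inner I u v = (\<Sum>\<^sub>\<infinity>i\<in>I. u i * cnj (v i))"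

definition l2_orth :: "'i set \<Rightarrow> ('i \<Rightarrow> complex) set \<Rightarrow> ('i \<Rightarrow> complex) set" where
  "l2_orth I W = {u \<in> l2 I. \<forall>w\<in>W. l2_inner I u w = 0}"

text \<open>The orthogonal projection onto \<open>W\<close>; meaningful for closed subspaces \<open>W\<close> of \<open>l2 I\<close>.\<close>

definition l2_proj :: "'i set \<Rightarrow> ('i \<Rightarrow> complex) set \<Rightarrow> ('i \<Rightarrow> complex) \<Rightarrow> ('i \<Rightarrow> complex)" where
  "l2_proj I W u = (THE w. w \<in> W \<and> (\<lambda>i. u i - w i) \<in> l2_orth I W)"

definition proj_matrix :: "'i set \<Rightarrow> ('i \<Rightarrow> complex) set \<Rightarrow> 'i \<Rightarrow> 'i \<Rightarrow> complex" where
  "proj_matrix I W i j = l2_inner I (l2_proj I W (indicator {j})) (indicator {i})"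


section \<open>Von Neumann dimension\<close>

text \<open>The left regular representation on the direct sum of \<open>n\<close> copies of the square-summable
  functions on the group, realised on the index set \<open>carrier \<Gamma> \<times> {..<n}\<close>.\<close>

definition left_regular ::
  "('a, 'c) monoid_scheme \<Rightarrow> nat \<Rightarrow> 'a \<Rightarrow> ('a \<times> nat \<Rightarrow> complex) \<Rightarrow> ('a \<times> nat \<Rightarrow> complex)" where
  "left_regular \<Gamma> n \<gamma> f =
     (\<lambda>(x, k). if x \<in> carrier \<Gamma> \<and> k < n then f (inv\<^bsub>\<Gamma>\<^esub> \<gamma> \<otimes>\<^bsub>\<Gamma>\<^esub> x, k) else 0)"

definition hilbert_module_embedding ::
  "('a, 'c) monoid_scheme \<Rightarrow> 'i set \<Rightarrow> ('a \<Rightarrow> ('i \<Rightarrow> complex) \<Rightarrow> ('i \<Rightarrow> complex)) \<Rightarrow>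
   ('i \<Rightarrow> complex) set \<Rightarrow> nat \<Rightarrow> (('i \<Rightarrow> complex) \<Rightarrow> ('a \<times> nat \<Rightarrow> complex)) \<Rightarrow> bool" where
  "hilbert_module_embedding \<Gamma> I act H n U \<longleftrightarrow>
     U ` H \<subseteq> l2 (carrier \<Gamma> \<times> {..<n}) \<and>
     (\<forall>u\<in>H. \<forall>v\<in>H. \<forall>a b. U (\<lambda>i. a * u i + b * v i) = (\<lambda>p. a * U u p + b * U v p)) \<and>
     (\<forall>u\<in>H. \<forall>v\<in>H. l2_inner (carrier \<Gamma> \<times> {..<n}) (U u) (U v) = l2_inner I u v) \<and>
     (\<forall>\<gamma>\<in>carrier \<Gamma>. \<forall>u\<in>H. U (act \<gamma> u) = left_regular \<Gamma> n \<gamma> (U u))"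

text \<open>The von Neumann dimension of a finitely generated Hilbert module \<open>H\<close> (a closed subspace of
  \<open>l2 I\<close>, invariant under the unitary action \<open>act\<close>): embed \<open>H\<close> isometrically and equivariantly
  into finitely many copies of the regular representation and take the von Neumann trace of the
  orthogonal projection onto the image. The value does not depend on the embedding.\<close>

definition vn_dim ::
  "('a, 'c) monoid_scheme \<Rightarrow> 'i set \<Rightarrow> ('a \<Rightarrow> ('i \<Rightarrow> complex) \<Rightarrow> ('i \<Rightarrow> complex)) \<Rightarrow>
   ('i \<Rightarrow> complex) set \<Rightarrow> real" where
  "vn_dim \<Gamma> I act H =
     (THE d. \<exists>n U. hilbert_module_embedding \<Gamma> I act H n U \<and>
        complex_of_real d =
          (\<Sum>k<n. proj_matrix (carrier \<Gamma> \<times> {..<n}) (U ` H) (\<one>\<^bsub>\<Gamma>\<^esub>, k) (\<one>\<^bsub>\<Gamma>\<^esub>, k)))"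


section \<open>Cayley graphs and their chains\<close>

text \<open>The undirected edge between \<open>x\<close> and \<open>y\<close> is the set \<open>{x, y}\<close>; thus each pair \<open>s\<close>, \<open>s\<inverse>\<close> of
  generators (and each involution) contributes a single edge. The fields \<open>tail\<close> and \<open>head\<close>
  record the arbitrary orientation of each undirected edge that is used to define chains.\<close>

definition cayley_edges :: "('a, 'c) monoid_scheme \<Rightarrow> 'a set \<Rightarrow> 'a set set" where
  "cayley_edges \<Gamma> S = {{\<gamma>, \<gamma> \<otimes>\<^bsub>\<Gamma>\<^esub> s} |\<gamma> s. \<gamma> \<in> carrier \<Gamma> \<and> s \<in> S}"

definition oriented_cayley_graph ::
  "('a, 'c) monoid_scheme \<Rightarrow> 'a set \<Rightarrow> ('a, 'a set) pre_digraph \<Rightarrow> bool" where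
  "oriented_cayley_graph \<Gamma> S G \<longleftrightarrow>
     verts G = carrier \<Gamma> \<and> arcs G = cayley_edges \<Gamma> S \<and>
     (\<forall>e\<in>arcs G. e = {tail G e, head G e})"

definition boundary :: "('v, 'e) pre_digraph \<Rightarrow> ('e \<Rightarrow> complex) \<Rightarrow> ('v \<Rightarrow> complex)" where
  "boundary G u = (\<lambda>x. (\<Sum>e\<in>in_arcs G x. u e) - (\<Sum>e\<in>out_arcs G x. u e))"

text \<open>The adjoint of \<^const>\<open>boundary\<close>, written out.\<close>

definition coboundary :: "('v, 'e) pre_digraph \<Rightarrow> ('v \<Rightarrow> complex) \<Rightarrow> ('e \<Rightarrow> complex)" where
  "coboundary G f = (\<lambda>e. if e \<in> arcs G then f (head G e) - f (tail G e) else 0)"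

definition finite_chains :: "('v, 'e) pre_digraph \<Rightarrow> ('e \<Rightarrow> complex) set" where
  "finite_chains G = {u. finite {e. u e \<noteq> 0} \<and> {e. u e \<noteq> 0} \<subseteq> arcs G}"

definition finite_cycles :: "('v, 'e) pre_digraph \<Rightarrow> ('e \<Rightarrow> complex) set" where
  "finite_cycles G = {u \<in> finite_chains G. \<forall>x\<in>verts G. boundary G u x = 0}"

definition l2_coboundaries :: "('v, 'e) pre_digraph \<Rightarrow> ('e \<Rightarrow> complex) set" where
  "l2_coboundaries G = coboundary G ` l2 (verts G)"

text \<open>Left translation of 1-chains by group elements. As \<open>\<gamma>\<close> need not preserve the chosen
  orientation, the value of a chain on the edge from \<open>x\<close> to \<open>y\<close> carries a sign.\<close>

definition chain_value :: "('a, 'a set) pre_digraph \<Rightarrow> ('a set \<Rightarrow> complex) \<Rightarrow> 'a \<Rightarrow> 'a \<Rightarrow> complex" where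
  "chain_value G u x y = (if tail G {x, y} = x then u {x, y} else - u {x, y})"

definition chain_act ::
  "('a, 'c) monoid_scheme \<Rightarrow> ('a, 'a set) pre_digraph \<Rightarrow> 'a \<Rightarrow>
   ('a set \<Rightarrow> complex) \<Rightarrow> ('a set \<Rightarrow> complex)" where
  "chain_act \<Gamma> G \<gamma> u =
     (\<lambda>e. if e \<in> arcs G
          then chain_value G u (inv\<^bsub>\<Gamma>\<^esub> \<gamma> \<otimes>\<^bsub>\<Gamma>\<^esub> tail G e) (inv\<^bsub>\<Gamma>\<^esub> \<gamma> \<otimes>\<^bsub>\<Gamma>\<^esub> head G e)
          else 0)"

text \<open>The first \<open>l\<^sup>2\<close>-Betti number of \<open>\<Gamma>\<close>, computed on an oriented Cayley graph \<open>G\<close> as the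
  dimension of the space of harmonic 1-cochains that vanish on all finite cycles. These are the
  harmonic 1-cocycles of the Cayley 2-complex, the boundaries of whose 2-cells span the finite
  cycles.\<close>

definition first_l2_betti :: "('a, 'c) monoid_scheme \<Rightarrow> ('a, 'a set) pre_digraph \<Rightarrow> real" where
  "first_l2_betti \<Gamma> G =
     vn_dim \<Gamma> (arcs G) (chain_act \<Gamma> G)
       (l2_orth (arcs G) (l2_coboundaries G) \<inter> l2_orth (arcs G) (finite_cycles G))"


section \<open>Determinantal measures and the free uniform spanning forest\<close>

text \<open>The \<open>\<sigma>\<close>-algebra is the product one. Finite subsets of \<open>E\<close> are enumerated by distinct lists
  so that the minors become matrices indexed by natural numbers; the determinant does not depend on
  the enumeration.\<close>

definition determinantal_measure :: "'e set \<Rightarrow> ('e \<Rightarrow> 'e \<Rightarrow> complex) \<Rightarrow> 'e set measure \<Rightarrow> bool" where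
  "determinantal_measure E Q M \<longleftrightarrow>
     prob_space M \<and>
     space M = Pow E \<and>
     sets M = sigma_sets (Pow E) {{F. F \<subseteq> E \<and> e \<in> F} |e. e \<in> E} \<and>
     (\<forall>ds. distinct ds \<and> set ds \<subseteq> E \<longrightarrow>
        complex_of_real (measure M {F \<in> space M. set ds \<subseteq> F}) =
        Determinant.det (Matrix.mat (length ds) (length ds) (\<lambda>(i, j). Q (ds ! i) (ds ! j))))"

text \<open>\<open>M\<close> is the (unique) measure FSF of \<open>G\<close>.\<close>

definition free_uniform_spanning_forest :: "('v, 'e) pre_digraph \<Rightarrow> 'e set measure \<Rightarrow> bool" where
  "free_uniform_spanning_forest G M \<longleftrightarrow>
     determinantal_measure (arcs G) (proj_matrix (arcs G) (l2_orth (arcs G) (finite_cycles G))) M"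

end

theory Submission
  imports Defs
begin

text \<open>Write \<open>E\<close> for the edges, \<open>B\<close> for the square-summable coboundaries and \<open>Z\<close> for the finite cycles. As
  \<open>Z\<close> is orthogonal to \<open>B\<close>, the space \<open>Z\<^sup>\<bottom>\<close> is the orthogonal sum of the closure of \<open>B\<close> and the harmonic
  space \<open>H = B\<^sup>\<bottom> \<inter> Z\<^sup>\<bottom>\<close>, so the expected degree at \<open>v\<close> is the sum over the edges \<open>e\<close> at \<open>v\<close> of the two
  diagonal entries of the projections onto these spaces.

  For \<open>H\<close>, let \<open>b\<^sub>j \<in> H\<close> represent the \<open>j\<close>-th coordinate of an equivariant isometric embedding of \<open>H\<close>.
  The array \<open>\<bar>b\<^sub>j e\<bar>\<^sup>2\<close> has the diagonal entries of the two projections as its row and column sums and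
  is invariant under \<open>\<Gamma>\<close>, so a mass transport, in which each edge is counted at both of its ends, shows
  that the sum over the edges at \<open>v\<close> is twice the von Neumann dimension.

  For the closure of \<open>B\<close>, replace the projection by the minimizer of the penalized distance
  \<open>\<parallel>1\<^sub>e - \<delta> f\<parallel>\<^sup>2 + t \<parallel>f\<parallel>\<^sup>2\<close>, which is explicit in terms of the Green function \<open>g\<^sub>t\<close> of the walk killed at
  rate \<open>t\<close>. The regularized sum at \<open>v\<close> is exactly \<open>2 - 2 t g\<^sub>t(1)\<close>. Finally \<open>t g\<^sub>t\<close> has total mass at
  most 1 and oscillates by at most \<open>\<surd>t\<close> along edges, so on an infinite group \<open>t g\<^sub>t(1) \<longlonglongrightarrow> 0\<close>.\<close>

section \<open>Square-summable functions\<close>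

text \<open>The squared norm as a real number, with the default value 0 if the sum does not
  exist.\<close>

definition l2_sq :: "'i set \<Rightarrow> ('i \<Rightarrow> complex) \<Rightarrow> real" where
  "l2_sq I u = (\<Sum>\<^sub>\<infinity>i\<in>I. (cmod (u i))\<^sup>2)"

lemma l2_outside: "u \<in> l2 I \<Longrightarrow> i \<notin> I \<Longrightarrow> u i = 0"
  by (simp add: l2_def)

lemma l2_summable: "u \<in> l2 I \<Longrightarrow> (\<lambda>i. (cmod (u i))\<^sup>2) summable_on I"
  by (simp add: l2_def)

lemma l2_sq_has_sum: "u \<in> l2 I \<Longrightarrow> ((\<lambda>i. (cmod (u i))\<^sup>2) has_sum l2_sq I u) I"
  by (simp add: l2_sq_def l2_summable)

lemma l2_sq_nonneg: "0 \<le> l2_sq I u"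
  unfolding l2_sq_def by (rule infsum_nonneg) simp

text \<open>Comparison with |x + y|^2 \<le> 2 |x|^2 + 2 |y|^2. Closure under sums, differences and
  multiples is read off by specializing the coefficients.\<close>

lemma l2_lin:
  assumes "u \<in> l2 I" "v \<in> l2 I"
  shows "(\<lambda>i. a * u i + b * v i) \<in> l2 I"
proof -
  have "(\<lambda>i. 2 * ((cmod a)\<^sup>2 * (cmod (u i))\<^sup>2) + 2 * ((cmod b)\<^sup>2 * (cmod (v i))\<^sup>2)) summable_on I"
    using assms by (intro summable_on_add summable_on_cmult_right l2_summable)
  moreover have "(cmod (a * u i + b * v i))\<^sup>2
      \<le> 2 * ((cmod a)\<^sup>2 * (cmod (u i))\<^sup>2) + 2 * ((cmod b)\<^sup>2 * (cmod (v i))\<^sup>2)" for i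
  proof -
    have "(cmod (a * u i + b * v i))\<^sup>2 \<le> (cmod (a * u i) + cmod (b * v i))\<^sup>2"
      by (intro power_mono norm_triangle_ineq) simp
    also have "\<dots> \<le> 2 * (cmod (a * u i))\<^sup>2 + 2 * (cmod (b * v i))\<^sup>2"
      using zero_le_power2[of "cmod (a * u i) - cmod (b * v i)"]
      by (simp add: power2_eq_square algebra_simps)
    finally show ?thesis by (simp add: norm_mult power_mult_distrib)
  qed
  ultimately have "(\<lambda>i. (cmod (a * u i + b * v i))\<^sup>2) summable_on I"
    by (rule summable_on_comparison_test) auto
  then show ?thesis using assms by (simp add: l2_def)
qed

lemma l2_zero: "(\<lambda>i. 0) \<in> l2 I"
  by (simp add: l2_def)

lemma l2_add: "u \<in> l2 I \<Longrightarrow> v \<in> l2 I \<Longrightarrow> (\<lambda>i. u i + v i) \<in> l2 I"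
  using l2_lin[of u I v 1 1] by simp

lemma l2_diff: "u \<in> l2 I \<Longrightarrow> v \<in> l2 I \<Longrightarrow> (\<lambda>i. u i - v i) \<in> l2 I"
  using l2_lin[of u I v 1 "-1"] by simp

lemma l2_scale: "u \<in> l2 I \<Longrightarrow> (\<lambda>i. a * u i) \<in> l2 I"
  using l2_lin[of u I u a 0] by simp

lemmas l2_ops = l2_zero l2_add l2_diff l2_scale l2_lin

lemma l2_finite_support:
  assumes "finite {i. u i \<noteq> 0}" "{i. u i \<noteq> 0} \<subseteq> I"
  shows "u \<in> l2 I"
proof -
  have "(\<lambda>i. (cmod (u i))\<^sup>2) summable_on I"
    by (rule finite_nonzero_values_imp_summable_on, rule finite_subset[OF _ assms(1)]) auto
  then show ?thesis using assms(2) by (auto simp: l2_def)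
qed

lemma l2_indicator: "j \<in> I \<Longrightarrow> indicator {j} \<in> l2 I"
  by (rule l2_finite_support) (auto simp: indicator_def)

lemma l2_inner_summable:
  assumes "u \<in> l2 I" "v \<in> l2 I"
  shows "(\<lambda>i. u i * cnj (v i)) summable_on I"
proof (rule abs_summable_summable, rule summable_on_comparison_test)
  show "(\<lambda>i. (cmod (u i))\<^sup>2 + (cmod (v i))\<^sup>2) summable_on I"
    using assms by (intro summable_on_add l2_summable)
  fix i
  show "0 \<le> cmod (u i * cnj (v i))" by simp
  show "cmod (u i * cnj (v i)) \<le> (cmod (u i))\<^sup>2 + (cmod (v i))\<^sup>2"
    using zero_le_power2[of "cmod (u i) - cmod (v i)"] mult_nonneg_nonneg[of "cmod (u i)" "cmod (v i)"]
    unfolding norm_mult complex_mod_cnj by (simp add: power2_eq_square algebra_simps del: mult_nonneg_nonneg)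
qed

lemma l2_inner_has_sum:
  "u \<in> l2 I \<Longrightarrow> v \<in> l2 I \<Longrightarrow> ((\<lambda>i. u i * cnj (v i)) has_sum l2_inner I u v) I"
  by (simp add: l2_inner_def l2_inner_summable)

lemma l2_inner_lin_left:
  assumes "u \<in> l2 I" "v \<in> l2 I" "w \<in> l2 I"
  shows "l2_inner I (\<lambda>i. a * u i + b * v i) w = a * l2_inner I u w + b * l2_inner I v w"
proof -
  have "((\<lambda>i. a * (u i * cnj (w i)) + b * (v i * cnj (w i))) has_sum
      a * l2_inner I u w + b * l2_inner I v w) I"
    using assms by (intro has_sum_add has_sum_cmult_right l2_inner_has_sum)
  then show ?thesis unfolding l2_inner_def
    by (intro infsumI) (simp add: algebra_simps)
qed

lemma l2_inner_commute: "l2_inner I v u = cnj (l2_inner I u v)"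
proof -
  have "cnj (l2_inner I u v) = (\<Sum>\<^sub>\<infinity>i\<in>I. cnj (u i * cnj (v i)))"
    unfolding l2_inner_def by (rule infsum_cnj[symmetric])
  also have "\<dots> = l2_inner I v u" unfolding l2_inner_def by (simp add: mult.commute)
  finally show ?thesis ..
qed

lemma l2_inner_lin_right:
  assumes "u \<in> l2 I" "v \<in> l2 I" "w \<in> l2 I"
  shows "l2_inner I w (\<lambda>i. a * u i + b * v i) = cnj a * l2_inner I w u + cnj b * l2_inner I w v"
  unfolding l2_inner_commute[of I w] l2_inner_lin_left[OF assms] by simp

lemma l2_inner_diff_left:
  "u \<in> l2 I \<Longrightarrow> v \<in> l2 I \<Longrightarrow> w \<in> l2 I \<Longrightarrow>
    l2_inner I (\<lambda>i. u i - v i) w = l2_inner I u w - l2_inner I v w"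
  using l2_inner_lin_left[of u I v w 1 "-1"] by simp

lemma l2_inner_diff_right:
  "u \<in> l2 I \<Longrightarrow> v \<in> l2 I \<Longrightarrow> w \<in> l2 I \<Longrightarrow>
    l2_inner I w (\<lambda>i. u i - v i) = l2_inner I w u - l2_inner I w v"
  using l2_inner_lin_right[of u I v w 1 "-1"] by simp

lemma l2_inner_add_left:
  "u \<in> l2 I \<Longrightarrow> v \<in> l2 I \<Longrightarrow> w \<in> l2 I \<Longrightarrow>
    l2_inner I (\<lambda>i. u i + v i) w = l2_inner I u w + l2_inner I v w"
  using l2_inner_lin_left[of u I v w 1 1] by simp

lemma l2_inner_add_right:
  "u \<in> l2 I \<Longrightarrow> v \<in> l2 I \<Longrightarrow> w \<in> l2 I \<Longrightarrow>
    l2_inner I w (\<lambda>i. u i + v i) = l2_inner I w u + l2_inner I w v"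
  using l2_inner_lin_right[of u I v w 1 1] by simp

lemma l2_inner_self: "l2_inner I u u = complex_of_real (l2_sq I u)"
proof -
  have "l2_inner I u u = (\<Sum>\<^sub>\<infinity>i\<in>I. complex_of_real ((cmod (u i))\<^sup>2))"
    unfolding l2_inner_def by (simp only: complex_norm_square)
  also have "\<dots> = complex_of_real (l2_sq I u)"
  proof (cases "(\<lambda>i. (cmod (u i))\<^sup>2) summable_on I")
    case True
    then show ?thesis unfolding l2_sq_def by (intro infsumI has_sum_of_real) simp
  next
    \<comment> \<open>Without summability both infinite sums take the default value 0.\<close>
    case False
    then have "\<not> (\<lambda>i. complex_of_real ((cmod (u i))\<^sup>2)) summable_on I"
      by (auto dest: summable_on_Re)
    with False show ?thesis unfolding l2_sq_def by (simp add: infsum_not_exists)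
  qed
  finally show ?thesis .
qed

lemma l2_sq_eq_Re_inner: "l2_sq I u = Re (l2_inner I u u)"
  by (simp add: l2_inner_self)

lemma l2_sq_diff:
  assumes "u \<in> l2 I" "v \<in> l2 I"
  shows "l2_sq I (\<lambda>i. u i - v i) = l2_sq I u + l2_sq I v - 2 * Re (l2_inner I u v)"
proof -
  have "l2_inner I (\<lambda>i. u i - v i) (\<lambda>i. u i - v i)
      = l2_inner I u u - l2_inner I u v - (l2_inner I v u - l2_inner I v v)"
    using assms by (simp add: l2_inner_diff_left l2_inner_diff_right l2_diff)
  then show ?thesis
    by (simp add: l2_sq_eq_Re_inner l2_inner_commute[of I v u])
qed

lemma l2_sq_scale: "l2_sq I (\<lambda>i. c * u i) = (cmod c)\<^sup>2 * l2_sq I u"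
  unfolding l2_sq_def by (simp add: norm_mult power_mult_distrib infsum_cmult_right')

lemma l2_component_le:
  assumes "u \<in> l2 I" shows "(cmod (u i))\<^sup>2 \<le> l2_sq I u"
proof (cases "i \<in> I")
  case True
  then have "(\<Sum>j\<in>{i}. (cmod (u j))\<^sup>2) \<le> l2_sq I u"
    unfolding l2_sq_def by (intro finite_sum_le_infsum l2_summable assms) auto
  then show ?thesis by simp
qed (use assms in \<open>simp add: l2_outside l2_sq_nonneg\<close>)

lemma l2_sq_eq_0:
  assumes "u \<in> l2 I" "l2_sq I u = 0"
  shows "u = (\<lambda>i. 0)"
proof
  fix i show "u i = 0" using l2_component_le[OF assms(1), of i] assms(2) by simp
qed

lemma l2_inner_indicator:
  assumes "j \<in> I" shows "l2_inner I u (indicator {j}) = u j"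
proof -
  have "l2_inner I u (indicator {j}) = (\<Sum>\<^sub>\<infinity>i\<in>{j}. u i * cnj (indicator {j} i))"
    unfolding l2_inner_def by (rule infsum_cong_neutral) (use assms in auto)
  then show ?thesis by simp
qed

lemma l2_inner_indicator_left:
  assumes "j \<in> I" shows "l2_inner I (indicator {j}) u = cnj (u j)"
  using l2_inner_indicator[OF assms, of u] l2_inner_commute by metis

text \<open>For \<open>d = 0\<close> this is the Cauchy--Schwarz inequality; for \<open>d\<close> the squared distance of \<open>u\<close> to a
  subspace, it bounds the inner product of an almost minimizing remainder with that subspace.\<close>

lemma l2_inner_distance_bound:
  assumes u: "u \<in> l2 I" and v: "v \<in> l2 I"
    and d: "\<And>c. d \<le> l2_sq I (\<lambda>i. u i - c * v i)"
  shows "(cmod (l2_inner I u v))\<^sup>2 \<le> (l2_sq I u - d) * l2_sq I v"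
proof (cases "l2_sq I v = 0")
  case True
  then have "v = (\<lambda>i. 0)" by (rule l2_sq_eq_0[OF v])
  then show ?thesis by (simp add: l2_inner_def l2_sq_def)
next
  case False
  then have pos: "0 < l2_sq I v" using l2_sq_nonneg[of I v] by simp
  define z where "z = l2_inner I u v"
  \<comment> \<open>\<open>c * v\<close> is the orthogonal projection of \<open>u\<close> onto the
    line through \<open>v\<close>; subtracting it lowers the squared norm by |<u, v>|^2 /
    |v|^2.\<close>
  define c where "c = z / of_real (l2_sq I v)"
  have "l2_inner I u (\<lambda>i. c * v i) = cnj c * z"
    using l2_inner_lin_right[OF v v u, of c 0] by (simp add: z_def)
  also have "\<dots> = of_real ((cmod z)\<^sup>2 / l2_sq I v)"
    using complex_norm_square[of z] by (simp add: c_def mult.commute)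
  finally have "l2_sq I (\<lambda>i. u i - c * v i)
      = l2_sq I u + (cmod c)\<^sup>2 * l2_sq I v - 2 * ((cmod z)\<^sup>2 / l2_sq I v)"
    by (simp add: l2_sq_diff[OF u l2_scale[OF v]] l2_sq_scale)
  moreover have "(cmod c)\<^sup>2 * l2_sq I v = (cmod z)\<^sup>2 / l2_sq I v"
    using pos by (simp add: c_def norm_divide power_divide power2_eq_square)
  ultimately have "d \<le> l2_sq I u - (cmod z)\<^sup>2 / l2_sq I v" using d[of c] by simp
  then show ?thesis using pos by (simp add: z_def field_simps)
qed

lemma l2_Cauchy_Schwarz:
  assumes "u \<in> l2 I" "v \<in> l2 I"
  shows "(cmod (l2_inner I u v))\<^sup>2 \<le> l2_sq I u * l2_sq I v"
  using l2_inner_distance_bound[OF assms, of 0] by (simp add: l2_sq_nonneg)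

lemma l2_sq_add:
  assumes "u \<in> l2 I" "v \<in> l2 I"
  shows "l2_sq I (\<lambda>i. u i + v i) = l2_sq I u + l2_sq I v + 2 * Re (l2_inner I u v)"
  using l2_sq_diff[OF assms(1) l2_scale[OF assms(2), of "-1"]]
    l2_inner_lin_right[OF assms(2,2,1), of "-1" 0] l2_sq_scale[of I "-1" v] by simp

text \<open>Continuity of the inner product, by Cauchy--Schwarz applied to \<open>f n - w\<close>
  and \<open>v\<close>. Convergence in norm is expressed throughout by squared distances tending to
  0.\<close>

lemma l2_inner_tendsto:
  assumes f: "\<And>n::nat. f n \<in> l2 I" and w: "w \<in> l2 I" and v: "v \<in> l2 I"
    and lim: "(\<lambda>n. l2_sq I (\<lambda>i. f n i - w i)) \<longlonglongrightarrow> 0"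
  shows "(\<lambda>n. l2_inner I (f n) v) \<longlonglongrightarrow> l2_inner I w v"
proof -
  have "(\<lambda>n. sqrt (l2_sq I (\<lambda>i. f n i - w i) * l2_sq I v)) \<longlonglongrightarrow> sqrt (0 * l2_sq I v)"
    by (intro tendsto_intros lim)
  then have "(\<lambda>n. sqrt (l2_sq I (\<lambda>i. f n i - w i) * l2_sq I v)) \<longlonglongrightarrow> 0" by simp
  then have "(\<lambda>n. l2_inner I (f n) v - l2_inner I w v) \<longlonglongrightarrow> 0"
  proof (rule Lim_null_comparison[rotated], intro always_eventually allI)
    fix n
    have "(cmod (l2_inner I (f n) v - l2_inner I w v))\<^sup>2 \<le> l2_sq I (\<lambda>i. f n i - w i) * l2_sq I v"
      using l2_Cauchy_Schwarz[OF l2_diff[OF f w] v] by (simp add: l2_inner_diff_left[OF f w v])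
    then show "norm (l2_inner I (f n) v - l2_inner I w v) \<le> sqrt (l2_sq I (\<lambda>i. f n i - w i) * l2_sq I v)"
      by (rule real_le_rsqrt)
  qed
  then show ?thesis by (simp add: LIM_zero_iff)
qed

section \<open>Completeness, closed subspaces and orthogonal projections\<close>

text \<open>Coordinates are dominated by the norm, so a Cauchy sequence has a pointwise limit
  \<open>w\<close>. Norm convergence follows by letting \<open>m\<close> tend to infinity in finite
  partial sums, which commute with the limit.\<close>

lemma l2_complete:
  fixes f :: "nat \<Rightarrow> 'i \<Rightarrow> complex"
  assumes f: "\<And>n. f n \<in> l2 I"
    and Cauchy: "\<And>e. 0 < e \<Longrightarrow> \<exists>N. \<forall>m\<ge>N. \<forall>n\<ge>N. l2_sq I (\<lambda>i. f m i - f n i) \<le> e"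
  obtains w where "w \<in> l2 I" "(\<lambda>n. l2_sq I (\<lambda>i. f n i - w i)) \<longlonglongrightarrow> 0"
proof -
  have "Cauchy (\<lambda>n. f n i)" for i
  proof (rule metric_CauchyI)
    fix e :: real assume e: "0 < e"
    then have "0 < e\<^sup>2 / 2" by simp
    then obtain N where N: "\<forall>m\<ge>N. \<forall>n\<ge>N. l2_sq I (\<lambda>i. f m i - f n i) \<le> e\<^sup>2 / 2"
      using Cauchy by blast
    have "dist (f m i) (f n i) < e" if "m \<ge> N" "n \<ge> N" for m n
    proof -
      have "(cmod (f m i - f n i))\<^sup>2 \<le> e\<^sup>2 / 2"
        using l2_component_le[OF l2_diff[OF f[of m] f[of n]], of i] N that by force
      also have "\<dots> < e\<^sup>2" using e by simp
      finally show ?thesis using e by (simp add: dist_norm power2_less_imp_less)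
    qed
    then show "\<exists>M. \<forall>m\<ge>M. \<forall>n\<ge>M. dist (f m i) (f n i) < e" by blast
  qed
  then have "\<exists>l. (\<lambda>n. f n i) \<longlonglongrightarrow> l" for i
    by (simp add: Cauchy_convergent_iff convergent_def)
  then obtain w where w: "\<And>i. (\<lambda>n. f n i) \<longlonglongrightarrow> w i" by metis
  have w0: "w i = 0" if "i \<notin> I" for i
    using w[of i] l2_outside[OF f that] by (simp add: LIMSEQ_const_iff)
  have bound: "(\<Sum>i\<in>F. (cmod (f n i - w i))\<^sup>2) \<le> e"
    if N: "\<forall>m\<ge>N. \<forall>n\<ge>N. l2_sq I (\<lambda>i. f m i - f n i) \<le> e" and "n \<ge> N" "finite F" "F \<subseteq> I" for e n N F
  proof (rule tendsto_upperbound)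
    show "(\<lambda>m. \<Sum>i\<in>F. (cmod (f n i - f m i))\<^sup>2) \<longlonglongrightarrow> (\<Sum>i\<in>F. (cmod (f n i - w i))\<^sup>2)"
      by (intro tendsto_intros w)
    have "(\<Sum>i\<in>F. (cmod (f n i - f m i))\<^sup>2) \<le> e" if "m \<ge> N" for m
    proof -
      have "(\<Sum>i\<in>F. (cmod (f n i - f m i))\<^sup>2) \<le> l2_sq I (\<lambda>i. f n i - f m i)"
        unfolding l2_sq_def using \<open>finite F\<close> \<open>F \<subseteq> I\<close>
        by (intro finite_sum_le_infsum l2_summable l2_diff f) auto
      then show ?thesis using N \<open>n \<ge> N\<close> that by force
    qed
    then show "\<forall>\<^sub>F m in sequentially. (\<Sum>i\<in>F. (cmod (f n i - f m i))\<^sup>2) \<le> e"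
      by (auto simp: eventually_sequentially)
  qed simp
  have diff: "(\<lambda>i. f n i - w i) \<in> l2 I \<and> l2_sq I (\<lambda>i. f n i - w i) \<le> e"
    if N: "\<forall>m\<ge>N. \<forall>n\<ge>N. l2_sq I (\<lambda>i. f m i - f n i) \<le> e" and "n \<ge> N" for e n N
  proof -
    have "(\<lambda>i. (cmod (f n i - w i))\<^sup>2) summable_on I"
      by (rule nonneg_bdd_above_summable_on) (auto intro!: bdd_aboveI[of _ e] bound[OF that])
    moreover from this have "l2_sq I (\<lambda>i. f n i - w i) \<le> e"
      unfolding l2_sq_def by (rule infsum_le_finite_sums) (rule bound[OF that])
    ultimately show ?thesis using w0 l2_outside[OF f] by (simp add: l2_def)
  qed
  show thesis
  proof
    obtain N where "\<forall>m\<ge>N. \<forall>n\<ge>N. l2_sq I (\<lambda>i. f m i - f n i) \<le> 1" using Cauchy[of 1] by auto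
    then have "(\<lambda>i. f N i - w i) \<in> l2 I" using diff[of N 1 N] by blast
    from l2_diff[OF f[of N] this] show "w \<in> l2 I" by simp
    show "(\<lambda>n. l2_sq I (\<lambda>i. f n i - w i)) \<longlonglongrightarrow> 0"
    proof (rule LIMSEQ_I)
      fix r :: real assume r: "0 < r"
      then obtain N where "\<forall>m\<ge>N. \<forall>n\<ge>N. l2_sq I (\<lambda>i. f m i - f n i) \<le> r / 2"
        using Cauchy[of "r / 2"] by auto
      then have "norm (l2_sq I (\<lambda>i. f n i - w i) - 0) < r" if "n \<ge> N" for n
        using diff[of N "r / 2" n] that r l2_sq_nonneg[of I "\<lambda>i. f n i - w i"] by auto
      then show "\<exists>no. \<forall>n\<ge>no. norm (l2_sq I (\<lambda>i. f n i - w i) - 0) < r" by blast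
    qed
  qed
qed

definition l2_subspace :: "'i set \<Rightarrow> ('i \<Rightarrow> complex) set \<Rightarrow> bool" where
  "l2_subspace I W \<longleftrightarrow> W \<subseteq> l2 I \<and> (\<lambda>i. 0) \<in> W \<and>
     (\<forall>u\<in>W. \<forall>v\<in>W. \<forall>a b. (\<lambda>i. a * u i + b * v i) \<in> W)"

text \<open>Sequential closedness in norm. The limit is required to lie in \<open>l2 I\<close>
  because \<open>l2_sq\<close> of a function that is not square-summable is 0 by default.\<close>

definition l2_closed :: "'i set \<Rightarrow> ('i \<Rightarrow> complex) set \<Rightarrow> bool" where
  "l2_closed I W \<longleftrightarrow> (\<forall>f w. (\<forall>n::nat. f n \<in> W) \<and> w \<in> l2 I \<and>
     (\<lambda>n. l2_sq I (\<lambda>i. f n i - w i)) \<longlonglongrightarrow> 0 \<longrightarrow> w \<in> W)"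

lemma l2_subspaceD:
  assumes "l2_subspace I W"
  shows "u \<in> W \<Longrightarrow> u \<in> l2 I" and "(\<lambda>i. 0) \<in> W"
    and "u \<in> W \<Longrightarrow> v \<in> W \<Longrightarrow> (\<lambda>i. a * u i + b * v i) \<in> W"
  using assms by (auto simp: l2_subspace_def)

lemma l2_subspace_diff:
  "l2_subspace I W \<Longrightarrow> u \<in> W \<Longrightarrow> v \<in> W \<Longrightarrow> (\<lambda>i. u i - v i) \<in> W"
  using l2_subspaceD(3)[of I W u v 1 "-1"] by simp

lemma l2_orthD:
  assumes "u \<in> l2_orth I W"
  shows "u \<in> l2 I" and "w \<in> W \<Longrightarrow> l2_inner I u w = 0" and "w \<in> W \<Longrightarrow> l2_inner I w u = 0"
  using assms l2_inner_commute[of I w u] by (auto simp: l2_orth_def)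

lemma l2_orth_subspace: "W \<subseteq> l2 I \<Longrightarrow> l2_subspace I (l2_orth I W)"
  by (auto simp: l2_subspace_def l2_orth_def l2_ops l2_inner_lin_left subset_eq)
    (simp add: l2_inner_def)

lemma l2_orth_closed:
  assumes "W \<subseteq> l2 I" shows "l2_closed I (l2_orth I W)"
  unfolding l2_closed_def
proof (intro allI impI, elim conjE)
  fix f w assume f: "\<forall>n::nat. f n \<in> l2_orth I W" and w: "w \<in> l2 I"
    and lim: "(\<lambda>n. l2_sq I (\<lambda>i. f n i - w i)) \<longlonglongrightarrow> 0"
  have "l2_inner I w v = 0" if v: "v \<in> W" for v
  proof -
    have "(\<lambda>n. l2_inner I (f n) v) \<longlonglongrightarrow> l2_inner I w v"
      by (rule l2_inner_tendsto[OF _ w _ lim]) (use f v assms in \<open>auto dest: l2_orthD(1)\<close>)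
    moreover have "l2_inner I (f n) v = 0" for n using f v by (blast dest: l2_orthD(2))
    ultimately show ?thesis by (simp add: LIMSEQ_const_iff)
  qed
  then show "w \<in> l2_orth I W" using w by (simp add: l2_orth_def)
qed

text \<open>Projection onto the closure of \<open>W\<close>, given as a limit of elements of
  \<open>W\<close>; this form serves the space of coboundaries, which need not be closed. A
  minimizing sequence for the distance to \<open>u\<close> is Cauchy by the parallelogram
  law.\<close>

lemma l2_approximate_projection:
  assumes W: "l2_subspace I W" and u: "u \<in> l2 I"
  obtains w f where "\<And>n::nat. f n \<in> W" "w \<in> l2 I"
    "(\<lambda>n. l2_sq I (\<lambda>i. f n i - w i)) \<longlonglongrightarrow> 0" "(\<lambda>i. u i - w i) \<in> l2_orth I W"
proof -
  define D where "D = (\<lambda>w. l2_sq I (\<lambda>i. u i - w i)) ` W"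
  define d where "d = Inf D"
  have bdd: "bdd_below D" unfolding D_def by (auto intro!: bdd_belowI[of _ 0] l2_sq_nonneg)
  have ne: "D \<noteq> {}" using l2_subspaceD(2)[OF W] by (auto simp: D_def)
  have d_le: "d \<le> l2_sq I (\<lambda>i. u i - w i)" if "w \<in> W" for w
    unfolding d_def using that bdd by (auto intro!: cInf_lower simp: D_def)
  have "\<exists>w\<in>W. l2_sq I (\<lambda>i. u i - w i) < d + e" if e: "0 < e" for e
  proof -
    obtain z where "z \<in> D" "z < d + e"
      using cInf_lessD[OF ne, of "d + e"] e unfolding d_def by auto
    then show ?thesis by (auto simp: D_def)
  qed
  then have "\<exists>w\<in>W. l2_sq I (\<lambda>i. u i - w i) < d + inverse (real (Suc n))" for n by simp
  then obtain f where f: "\<And>n. f n \<in> W"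
    and fd: "\<And>n. l2_sq I (\<lambda>i. u i - f n i) < d + inverse (real (Suc n))" by metis
  have fl: "f n \<in> l2 I" for n using l2_subspaceD(1)[OF W f] .
  have Cauchy: "l2_sq I (\<lambda>i. f m i - f n i) \<le> 2 * inverse (real (Suc m)) + 2 * inverse (real (Suc n))" for m n
  proof -
    \<comment> \<open>The midpoint of \<open>f m\<close> and \<open>f n\<close> has squared distance
      at least \<open>d\<close> from \<open>u\<close>, which by the parallelogram law leaves little
      room for \<open>f m - f n\<close>.\<close>
    have mid: "(\<lambda>i. (1/2) * f m i + (1/2) * f n i) \<in> W" by (rule l2_subspaceD(3)[OF W f f])
    have um: "(\<lambda>i. u i - f m i) \<in> l2 I" and un: "(\<lambda>i. u i - f n i) \<in> l2 I"
      by (intro l2_diff u fl)+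
    have "4 * d \<le> 4 * l2_sq I (\<lambda>i. u i - ((1/2) * f m i + (1/2) * f n i))"
      using d_le[OF mid] by simp
    also have "\<dots> = l2_sq I (\<lambda>i. 2 * (u i - ((1/2) * f m i + (1/2) * f n i)))"
      unfolding l2_sq_scale by simp
    also have "(\<lambda>i. 2 * (u i - ((1/2) * f m i + (1/2) * f n i))) = (\<lambda>i. (u i - f m i) + (u i - f n i))"
      by (auto simp: field_simps)
    finally have "4 * d \<le> l2_sq I (\<lambda>i. (u i - f m i) + (u i - f n i))" .
    moreover have "l2_sq I (\<lambda>i. f m i - f n i) = l2_sq I (\<lambda>i. (u i - f n i) - (u i - f m i))" by simp
    ultimately have "l2_sq I (\<lambda>i. f m i - f n i)
        \<le> 2 * l2_sq I (\<lambda>i. u i - f m i) + 2 * l2_sq I (\<lambda>i. u i - f n i) - 4 * d"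
      unfolding l2_sq_add[OF um un] l2_sq_diff[OF un um] l2_inner_commute[of I "\<lambda>i. u i - f n i"] by simp
    then show ?thesis using fd[of m] fd[of n] by linarith
  qed
  obtain w where w: "w \<in> l2 I" and lim: "(\<lambda>n. l2_sq I (\<lambda>i. f n i - w i)) \<longlonglongrightarrow> 0"
  proof (rule l2_complete[OF fl])
    fix e :: real assume "0 < e"
    then obtain N where N: "inverse (real (Suc N)) < e / 4"
      using reals_Archimedean[of "e / 4"] by auto
    have "inverse (real (Suc m)) < e / 4" if "m \<ge> N" for m
    proof -
      have "inverse (real (Suc m)) \<le> inverse (real (Suc N))" using that by (intro le_imp_inverse_le) auto
      then show ?thesis using N by linarith
    qed
    note inv = this
    have "l2_sq I (\<lambda>i. f m i - f n i) \<le> e" if "m \<ge> N" "n \<ge> N" for m n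
      using Cauchy[of m n] inv[OF that(1)] inv[OF that(2)] by linarith
    then show "\<exists>N. \<forall>m\<ge>N. \<forall>n\<ge>N. l2_sq I (\<lambda>i. f m i - f n i) \<le> e" by blast
  qed
  have "l2_inner I (\<lambda>i. u i - w i) v = 0" if v: "v \<in> W" for v
  proof -
    have vl: "v \<in> l2 I" using l2_subspaceD(1)[OF W v] .
    \<comment> \<open>The squared distance from \<open>u\<close> to \<open>f n\<close> exceeds the
      infimum \<open>d\<close> by less than 1/(n+1), so the remainder is almost orthogonal to
      \<open>v\<close>; in the limit it is orthogonal.\<close>
    have "(cmod (l2_inner I u v - l2_inner I (f n) v))\<^sup>2 \<le> inverse (real (Suc n)) * l2_sq I v" for n
    proof -
      have "d \<le> l2_sq I (\<lambda>i. (u i - f n i) - c * v i)" for c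
        using d_le[OF l2_subspaceD(3)[OF W f[of n] v, of 1 c]] by (simp add: algebra_simps)
      then have "(cmod (l2_inner I (\<lambda>i. u i - f n i) v))\<^sup>2 \<le> (l2_sq I (\<lambda>i. u i - f n i) - d) * l2_sq I v"
        by (intro l2_inner_distance_bound l2_diff u fl vl)
      also have "\<dots> \<le> inverse (real (Suc n)) * l2_sq I v"
        using fd[of n] by (intro mult_right_mono l2_sq_nonneg) simp
      finally show ?thesis by (simp add: l2_inner_diff_left[OF u fl vl])
    qed
    moreover have "(\<lambda>n. (cmod (l2_inner I u v - l2_inner I (f n) v))\<^sup>2)
        \<longlonglongrightarrow> (cmod (l2_inner I u v - l2_inner I w v))\<^sup>2"
      by (intro tendsto_intros l2_inner_tendsto[OF fl w vl lim])
    moreover have "(\<lambda>n. inverse (real (Suc n)) * l2_sq I v) \<longlonglongrightarrow> 0 * l2_sq I v"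
      by (intro tendsto_mult LIMSEQ_inverse_real_of_nat tendsto_const)
    ultimately have "(cmod (l2_inner I u v - l2_inner I w v))\<^sup>2 \<le> 0 * l2_sq I v"
      by (intro LIMSEQ_le) auto
    then show ?thesis by (simp add: l2_inner_diff_left[OF u w vl])
  qed
  then have "(\<lambda>i. u i - w i) \<in> l2_orth I W" using u w by (simp add: l2_orth_def l2_diff)
  then show thesis using that f w lim by blast
qed

text \<open>Two candidates differ by an element of \<open>W\<close> that is orthogonal to
  \<open>W\<close>, hence by 0. This is how the \<open>THE\<close> in \<open>l2_proj\<close> gets
  evaluated.\<close>

lemma l2_proj_eqI:
  assumes W: "l2_subspace I W" and w: "w \<in> W" "(\<lambda>i. u i - w i) \<in> l2_orth I W"
  shows "l2_proj I W u = w"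
  unfolding l2_proj_def
proof (rule the_equality)
  show "w \<in> W \<and> (\<lambda>i. u i - w i) \<in> l2_orth I W" using w by blast
  fix w' assume w': "w' \<in> W \<and> (\<lambda>i. u i - w' i) \<in> l2_orth I W"
  have x: "(\<lambda>i. w' i - w i) \<in> W" using l2_subspace_diff[OF W] w w' by blast
  have "l2_inner I (\<lambda>i. (u i - w i) - (u i - w' i)) (\<lambda>i. w' i - w i) = 0"
    using l2_orthD[OF w(2)] l2_orthD[of "\<lambda>i. u i - w' i" I W] w' x l2_subspaceD(1)[OF W x]
    by (subst l2_inner_diff_left) auto
  then have "l2_sq I (\<lambda>i. w' i - w i) = 0" by (simp add: l2_sq_eq_Re_inner)
  then have "(\<lambda>i. w' i - w i) = (\<lambda>i. 0)" by (rule l2_sq_eq_0[OF l2_subspaceD(1)[OF W x]])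
  then show "w' = w" by (simp add: fun_eq_iff)
qed

locale l2_closed_subspace =
  fixes I :: "'i set" and W :: "('i \<Rightarrow> complex) set"
  assumes subspace: "l2_subspace I W" and closed: "l2_closed I W"
begin

lemma mem_l2: "w \<in> W \<Longrightarrow> w \<in> l2 I"
  using l2_subspaceD(1)[OF subspace] .

lemma l2_proj_ex: "u \<in> l2 I \<Longrightarrow> \<exists>w\<in>W. (\<lambda>i. u i - w i) \<in> l2_orth I W"
  using l2_approximate_projection[OF subspace, of u] closed unfolding l2_closed_def by metis

lemma l2_proj_mem: "u \<in> l2 I \<Longrightarrow> l2_proj I W u \<in> W"
  and l2_proj_orth: "u \<in> l2 I \<Longrightarrow> (\<lambda>i. u i - l2_proj I W u i) \<in> l2_orth I W"
  using l2_proj_ex[of u] l2_proj_eqI[OF subspace] by metis+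

text \<open>The projection of \<open>indicator {i}\<close> is the reproducing kernel of
  \<open>W\<close>: it represents evaluation at \<open>i\<close> on \<open>W\<close>.\<close>

lemma inner_proj_indicator:
  assumes "w \<in> W" "i \<in> I" shows "l2_inner I w (l2_proj I W (indicator {i})) = w i"
proof -
  have "l2_inner I w (\<lambda>j. indicator {i} j - l2_proj I W (indicator {i}) j) = 0"
    using l2_orthD(3)[OF l2_proj_orth[OF l2_indicator] assms(1)] assms(2) .
  then show ?thesis
    using assms by (simp add: l2_inner_diff_right l2_indicator mem_l2 l2_proj_mem l2_inner_indicator)
qed

text \<open>The kernel evaluated at its own point is its squared norm, so traces of projections
  become sums of nonnegative reals.\<close>

lemma proj_matrix_diag:
  assumes "i \<in> I"
  shows "proj_matrix I W i i = complex_of_real (l2_sq I (l2_proj I W (indicator {i})))"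
  using inner_proj_indicator[OF l2_proj_mem[OF l2_indicator[OF assms]] assms]
  by (simp add: proj_matrix_def l2_inner_indicator assms l2_inner_self)

end

lemma l2_orth_closed_subspace: "W \<subseteq> l2 I \<Longrightarrow> l2_closed_subspace I (l2_orth I W)"
  by (simp add: l2_closed_subspace_def l2_orth_subspace l2_orth_closed)

lemma l2_sum: "finite A \<Longrightarrow> (\<And>k. k \<in> A \<Longrightarrow> f k \<in> l2 I) \<Longrightarrow> (\<lambda>i. \<Sum>k\<in>A. f k i) \<in> l2 I"
  by (induction A rule: finite_induct) (auto intro: l2_zero l2_add)

lemma l2_inner_sum_left:
  "finite A \<Longrightarrow> (\<And>k. k \<in> A \<Longrightarrow> f k \<in> l2 I) \<Longrightarrow> w \<in> l2 I \<Longrightarrow>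
    l2_inner I (\<lambda>i. \<Sum>k\<in>A. f k i) w = (\<Sum>k\<in>A. l2_inner I (f k) w)"
proof (induction A rule: finite_induct)
  case (insert k A)
  then show ?case by (simp add: l2_inner_add_left l2_sum)
qed (simp add: l2_inner_def)

text \<open>Preimages of a convergent sequence in the image are Cauchy by isometry, and their limit
  lies in the closed space \<open>H\<close>. This makes the projection onto the image, which occurs
  in the von Neumann trace, meaningful.\<close>

lemma l2_isometric_image_closed_subspace:
  assumes H: "l2_closed_subspace I H" and U: "U ` H \<subseteq> l2 J"
    and lin: "\<And>u v a b. u \<in> H \<Longrightarrow> v \<in> H \<Longrightarrow> U (\<lambda>i. a * u i + b * v i) = (\<lambda>j. a * U u j + b * U v j)"
    and isom: "\<And>u v. u \<in> H \<Longrightarrow> v \<in> H \<Longrightarrow> l2_inner J (U u) (U v) = l2_inner I u v"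
  shows "l2_closed_subspace J (U ` H)"
proof
  interpret H: l2_closed_subspace I H by fact
  have sub: "(\<lambda>i. a * u i + b * v i) \<in> H" if "u \<in> H" "v \<in> H" for u v a b
    using l2_subspaceD(3)[OF H.subspace that] .
  show "l2_subspace J (U ` H)"
    unfolding l2_subspace_def
  proof (intro conjI ballI allI U)
    have "U (\<lambda>i. 0) = (\<lambda>j. 0)"
      using lin[of "\<lambda>i. 0" "\<lambda>i. 0" 0 0] l2_subspaceD(2)[OF H.subspace] by simp
    then show "(\<lambda>j. 0) \<in> U ` H" using imageI[OF l2_subspaceD(2)[OF H.subspace], of U] by simp
    fix p q a b assume "p \<in> U ` H" "q \<in> U ` H"
    then obtain u v where uv: "u \<in> H" "v \<in> H" "p = U u" "q = U v" by blast
    then have "(\<lambda>j. a * p j + b * q j) = U (\<lambda>i. a * u i + b * v i)" by (simp add: lin)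
    then show "(\<lambda>j. a * p j + b * q j) \<in> U ` H" using sub[OF uv(1,2)] by simp
  qed
  show "l2_closed J (U ` H)"
    unfolding l2_closed_def
  proof (intro allI impI, elim conjE)
    fix f w assume f: "\<forall>n::nat. f n \<in> U ` H" and w: "w \<in> l2 J"
      and lim: "(\<lambda>n. l2_sq J (\<lambda>j. f n j - w j)) \<longlonglongrightarrow> 0"
    from f have "\<forall>n. \<exists>h. h \<in> H \<and> f n = U h" by blast
    then obtain h where h: "\<And>n. h n \<in> H" "\<And>n. f n = U (h n)" by metis
    have hl: "h n \<in> l2 I" for n using H.mem_l2 h(1) .
    have sq: "l2_sq I (\<lambda>i. u i - v i) = l2_sq J (\<lambda>j. U u j - U v j)" if "u \<in> H" "v \<in> H" for u v
    proof -
      have d: "(\<lambda>i. u i - v i) \<in> H" using l2_subspace_diff[OF H.subspace that] .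
      have "U (\<lambda>i. u i - v i) = (\<lambda>j. U u j - U v j)" using lin[OF that, of 1 "-1"] by simp
      with isom[OF d d] show ?thesis by (simp add: l2_sq_eq_Re_inner)
    qed
    obtain u where u: "u \<in> l2 I" and ulim: "(\<lambda>n. l2_sq I (\<lambda>i. h n i - u i)) \<longlonglongrightarrow> 0"
    proof (rule l2_complete[OF hl])
      fix e :: real assume e: "0 < e"
      have fl: "f n \<in> l2 J" for n using f U by blast
      from lim e have "\<forall>\<^sub>F n in sequentially. l2_sq J (\<lambda>j. f n j - w j) < e / 4"
        by (intro order_tendstoD(2)) auto
      then obtain N where N: "\<And>n. n \<ge> N \<Longrightarrow> l2_sq J (\<lambda>j. f n j - w j) < e / 4"
        by (auto simp: eventually_sequentially)
      have "l2_sq I (\<lambda>i. h m i - h n i) \<le> e" if "m \<ge> N" "n \<ge> N" for m n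
      proof -
        let ?x = "\<lambda>j. f m j - w j" and ?y = "\<lambda>j. f n j - w j"
        have xy: "?x \<in> l2 J" "?y \<in> l2 J" using fl w by (auto intro: l2_diff)
        \<comment> \<open>The parallelogram law; dropping the term with the sum gives |x - y|^2
          \<le> 2 |x|^2 + 2 |y|^2, whence the tolerance \<open>e / 4\<close>.\<close>
        have "l2_sq J (\<lambda>j. ?x j - ?y j) + l2_sq J (\<lambda>j. ?x j + ?y j) = 2 * l2_sq J ?x + 2 * l2_sq J ?y"
          by (simp only: l2_sq_diff[OF xy] l2_sq_add[OF xy])
        then have "l2_sq J (\<lambda>j. ?x j - ?y j) \<le> 2 * l2_sq J ?x + 2 * l2_sq J ?y"
          using l2_sq_nonneg[of J "\<lambda>j. ?x j + ?y j"] by linarith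
        moreover have "l2_sq I (\<lambda>i. h m i - h n i) = l2_sq J (\<lambda>j. ?x j - ?y j)"
          using sq[OF h(1) h(1), of m n] by (simp add: h(2)[symmetric])
        ultimately show ?thesis using N[OF that(1)] N[OF that(2)] by linarith
      qed
      then show "\<exists>N. \<forall>m\<ge>N. \<forall>n\<ge>N. l2_sq I (\<lambda>i. h m i - h n i) \<le> e" by blast
    qed
    have uH: "u \<in> H" using H.closed u ulim h(1) unfolding l2_closed_def by blast
    have Uu: "U u \<in> l2 J" using uH U by blast
    have lim': "(\<lambda>n. l2_sq J (\<lambda>j. f n j - U u j)) \<longlonglongrightarrow> 0"
      using ulim sq[OF h(1) uH] by (simp add: h(2))
    \<comment> \<open>Norm limits are unique: coordinates are inner products with indicators, and
      these converge to both values.\<close>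
    have "w j = U u j" for j
    proof (cases "j \<in> J")
      case True
      have fl: "f n \<in> l2 J" for n using f U by blast
      have "(\<lambda>n. l2_inner J (f n) (indicator {j})) \<longlonglongrightarrow> l2_inner J w (indicator {j})"
        "(\<lambda>n. l2_inner J (f n) (indicator {j})) \<longlonglongrightarrow> l2_inner J (U u) (indicator {j})"
        by (rule l2_inner_tendsto[OF fl w l2_indicator[OF True] lim],
            rule l2_inner_tendsto[OF fl Uu l2_indicator[OF True] lim'])
      from LIMSEQ_unique[OF this] show ?thesis by (simp add: l2_inner_indicator[OF True])
    qed (use w Uu in \<open>simp add: l2_outside\<close>)
    then have "w = U u" by (simp add: fun_eq_iff)
    then show "w \<in> U ` H" using uH by blast
  qed
qed

section \<open>Sums over products with a finite set\<close>

text \<open>Induction over the finite factor splits off one slice at a time. The generality of the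
  value type covers real and complex sums alike.\<close>

lemma has_sum_times_finite:
  fixes f :: "'s \<Rightarrow> 'x \<Rightarrow> 'b::topological_comm_monoid_add"
  assumes "finite S" and "\<And>s. s \<in> S \<Longrightarrow> (f s has_sum F s) A"
  shows "((\<lambda>(x, s). f s x) has_sum (\<Sum>s\<in>S. F s)) (A \<times> S)"
  using assms
proof (induction S)
  case (insert s S)
  have 1: "((\<lambda>(x, s). f s x) has_sum F s) ((\<lambda>x. (x, s)) ` A)"
    by (subst has_sum_reindex) (auto simp: inj_on_def o_def insert.prems)
  have 2: "((\<lambda>(x, s). f s x) has_sum (\<Sum>s\<in>S. F s)) (A \<times> S)"
    using insert.prems by (intro insert.IH) simp
  have 3: "(\<lambda>x. (x, s)) ` A \<inter> A \<times> S = {}" using insert.hyps by auto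
  have 4: "A \<times> insert s S = (\<lambda>x. (x, s)) ` A \<union> A \<times> S" by auto
  show ?case using has_sum_Un_disjoint[OF 1 2 3] insert.hyps by (simp add: 4)
qed simp

lemma has_sum_finite_sum:
  fixes f :: "'s \<Rightarrow> 'x \<Rightarrow> 'b::topological_comm_monoid_add"
  assumes "finite S" and "\<And>s. s \<in> S \<Longrightarrow> (f s has_sum F s) A"
  shows "((\<lambda>x. \<Sum>s\<in>S. f s x) has_sum (\<Sum>s\<in>S. F s)) A"
  using assms by (induction S rule: finite_induct) (auto intro: has_sum_add)

section \<open>Intensities of determinantal measures\<close>

text \<open>The defining identity for a one-element list, whose minor is a 1 by 1
  determinant.\<close>

lemma determinantal_measure_diag:
  assumes M: "determinantal_measure E Q M" and e: "e \<in> E"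
  shows "complex_of_real (measure M {F \<in> space M. e \<in> F}) = Q e e"
proof -
  have "\<forall>ds. distinct ds \<and> set ds \<subseteq> E \<longrightarrow>
      complex_of_real (measure M {F \<in> space M. set ds \<subseteq> F}) =
      Determinant.det (Matrix.mat (length ds) (length ds) (\<lambda>(i, j). Q (ds ! i) (ds ! j)))"
    using M unfolding determinantal_measure_def by (elim conjE)
  from this[THEN spec, of "[e]"] e
  have "complex_of_real (measure M {F \<in> space M. e \<in> F}) =
      Determinant.det (Matrix.mat 1 1 (\<lambda>(i, j). Q ([e] ! i) ([e] ! j)))" by simp
  also have "\<dots> = Q e e" by (subst det_single) auto
  finally show ?thesis .
qed

text \<open>Linearity of expectation: the count is a finite sum of indicators, so only the
  intensities of single edges enter.\<close>

lemma determinantal_measure_integral_card: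
  assumes M: "determinantal_measure E Q M" and T: "finite T" "T \<subseteq> E"
  shows "complex_of_real (\<integral>F. real (card (F \<inter> T)) \<partial>M) = (\<Sum>e\<in>T. Q e e)"
proof -
  interpret prob_space M using M by (simp add: determinantal_measure_def)
  let ?A = "\<lambda>e. {F \<in> space M. e \<in> F}"
  have sp: "space M = Pow E" using M by (simp add: determinantal_measure_def)
  have A: "?A e \<in> events" if "e \<in> T" for e
  proof -
    have "?A e = {F. F \<subseteq> E \<and> e \<in> F}" unfolding sp by auto
    moreover have "{F. F \<subseteq> E \<and> e \<in> F} \<in> sigma_sets (Pow E) {{F. F \<subseteq> E \<and> e \<in> F} |e. e \<in> E}"
      using that T by (intro sigma_sets.Basic) blast
    ultimately show ?thesis using M by (simp add: determinantal_measure_def)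
  qed
  have "(\<integral>F. real (card (F \<inter> T)) \<partial>M) = (\<integral>F. (\<Sum>e\<in>T. indicat_real (?A e) F) \<partial>M)"
  proof (rule Bochner_Integration.integral_cong[OF refl])
    fix F assume F: "F \<in> space M"
    have "(\<Sum>e\<in>T. indicat_real (?A e) F) = (\<Sum>e\<in>T. if e \<in> F then 1 else 0)"
      using F by (intro sum.cong) (auto simp: indicator_def)
    also have "\<dots> = real (card (F \<inter> T))"
      using T(1) by (simp add: sum.If_cases Int_commute)
    finally show "real (card (F \<inter> T)) = (\<Sum>e\<in>T. indicat_real (?A e) F)" by simp
  qed
  also have "\<dots> = (\<Sum>e\<in>T. prob (?A e))"
    using A by (subst Bochner_Integration.integral_sum) (auto intro!: sum.cong integrable_real_indicator simp: less_top[symmetric])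
  finally show ?thesis
    using determinantal_measure_diag[OF M] T(2) by (auto intro!: sum.cong)
qed

section \<open>Chains on Cayley graphs\<close>

locale cayley_graph = group \<Gamma> for \<Gamma> :: "('a, 'c) monoid_scheme" (structure) +
  fixes S :: "'a set" and G :: "('a, 'a set) pre_digraph"
  assumes infinite_carrier: "infinite (carrier \<Gamma>)"
    and finite_S: "finite S"
    and S_carrier: "S \<subseteq> carrier \<Gamma>"
    and generate_S: "generate \<Gamma> S = carrier \<Gamma>"
    and inv_S: "\<And>s. s \<in> S \<Longrightarrow> inv s \<in> S"
    and one_notin_S: "\<one> \<notin> S"
    and oriented: "oriented_cayley_graph \<Gamma> S G"
begin

abbreviation V :: "'a set" where "V \<equiv> carrier \<Gamma>"
abbreviation E :: "'a set set" where "E \<equiv> arcs G"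
abbreviation cv :: "('a set \<Rightarrow> complex) \<Rightarrow> 'a \<Rightarrow> 'a \<Rightarrow> complex" where "cv \<equiv> chain_value G"
abbreviation act :: "'a \<Rightarrow> ('a set \<Rightarrow> complex) \<Rightarrow> 'a set \<Rightarrow> complex" where "act \<equiv> chain_act \<Gamma> G"
abbreviation B :: "('a set \<Rightarrow> complex) set" where "B \<equiv> l2_coboundaries G"
abbreviation Z :: "('a set \<Rightarrow> complex) set" where "Z \<equiv> finite_cycles G"

lemma verts_eq: "verts G = V"
  using oriented by (simp add: oriented_cayley_graph_def)

lemma arcs_eq: "E = {{x, x \<otimes> s} |x s. x \<in> V \<and> s \<in> S}"
  using oriented by (simp add: oriented_cayley_graph_def cayley_edges_def)

lemma S_closed [simp]: "s \<in> S \<Longrightarrow> s \<in> V"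
  using S_carrier by blast

lemma arc_ends: "e \<in> E \<Longrightarrow> {tail G e, head G e} = e"
  using oriented by (auto simp: oriented_cayley_graph_def)

lemma mem_arc:
  assumes "e \<in> E" shows "x \<in> e \<longleftrightarrow> x = tail G e \<or> x = head G e"
  using arc_ends[OF assms] by (metis insert_iff singleton_iff)

lemma arcI [intro]: "x \<in> V \<Longrightarrow> s \<in> S \<Longrightarrow> {x, x \<otimes> s} \<in> E"
  unfolding arcs_eq by blast

lemma mult_S_neq: "x \<in> V \<Longrightarrow> s \<in> S \<Longrightarrow> x \<otimes> s \<noteq> x"
  using one_notin_S r_cancel_one'[of x s] by auto

lemma arcE:
  assumes "{x, y} \<in> E"
  obtains s where "x \<in> V" "s \<in> S" "y = x \<otimes> s" | s where "y \<in> V" "s \<in> S" "x = y \<otimes> s"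
proof -
  from assms obtain z s where "z \<in> V" "s \<in> S" "{x, y} = {z, z \<otimes> s}" unfolding arcs_eq by auto
  then show thesis using that by (metis doubleton_eq_iff)
qed

lemma arc_closed:
  assumes "{x, y} \<in> E" shows "x \<in> V" "y \<in> V"
  using assms by (auto elim!: arcE)

lemma arc_neq: "{x, y} \<in> E \<Longrightarrow> x \<noteq> y"
  by (metis arcE mult_S_neq)

lemma arc_gen:
  assumes "{x, y} \<in> E" shows "inv x \<otimes> y \<in> S"
  using assms
proof (cases rule: arcE)
  case (1 s) then show ?thesis by (simp add: m_assoc[symmetric])
next
  case (2 s) then show ?thesis using inv_S by (simp add: inv_mult_group m_assoc)
qed

lemma arc_iff: "{x, y} \<in> E \<longleftrightarrow> x \<in> V \<and> y \<in> V \<and> inv x \<otimes> y \<in> S"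
proof
  assume "x \<in> V \<and> y \<in> V \<and> inv x \<otimes> y \<in> S"
  then have "{x, x \<otimes> (inv x \<otimes> y)} \<in> E" "x \<otimes> (inv x \<otimes> y) = y"
    using arcI[of x "inv x \<otimes> y"] by (simp_all add: m_assoc[symmetric])
  then show "{x, y} \<in> E" by simp
qed (auto dest: arc_closed arc_gen)

lemma tail_head:
  assumes "e \<in> E"
  shows "tail G e \<in> V" "head G e \<in> V" "tail G e \<noteq> head G e"
    "inv (tail G e) \<otimes> head G e \<in> S" "inv (head G e) \<otimes> tail G e \<in> S"
proof -
  have a: "{tail G e, head G e} \<in> E"
    using arc_ends[OF assms] assms by simp
  then have "{head G e, tail G e} \<in> E" by (simp add: insert_commute)
  with a show "tail G e \<in> V" "head G e \<in> V" "tail G e \<noteq> head G e"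
    "inv (tail G e) \<otimes> head G e \<in> S" "inv (head G e) \<otimes> tail G e \<in> S"
    using arc_iff arc_neq by blast+
qed

lemma arc_cases:
  assumes "{x, y} \<in> E"
  obtains "tail G {x, y} = x" "head G {x, y} = y" | "tail G {x, y} = y" "head G {x, y} = x"
  using arc_ends[OF assms] by (auto simp: doubleton_eq_iff)

lemma cv_swap: "{x, y} \<in> E \<Longrightarrow> cv u y x = - cv u x y"
  by (frule arc_neq, erule arc_cases) (simp_all add: chain_value_def insert_commute)

lemma cv_arc:
  assumes "e \<in> E"
  shows "cv u (tail G e) (head G e) = u e" "cv u (head G e) (tail G e) = - u e"
proof -
  have e: "{tail G e, head G e} = e" "{head G e, tail G e} = e"
    using arc_ends[OF assms] by (simp_all add: insert_commute)
  show "cv u (tail G e) (head G e) = u e" "cv u (head G e) (tail G e) = - u e"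
    unfolding chain_value_def e using tail_head(3)[OF assms] by auto
qed

lemma cmod_cv: "cmod (cv u x y) = cmod (u {x, y})"
  by (simp add: chain_value_def)

lemma cv_lin: "cv (\<lambda>e. a * u e + b * w e) x y = a * cv u x y + b * cv w x y"
  by (simp add: chain_value_def algebra_simps)

section \<open>Splitting each edge into two opposite darts\<close>

text \<open>A dart is a base vertex together with a generator. Every edge has exactly two darts,
  also when the generator is an involution, so sums over edges become sums over
  \<open>V \<times> S\<close>, where left translation moves the first factor alone.\<close>

definition dart :: "'a set \<Rightarrow> 'a \<times> 'a" where "dart e = (tail G e, inv (tail G e) \<otimes> head G e)"
definition opposite_dart :: "'a set \<Rightarrow> 'a \<times> 'a" where
  "opposite_dart e = (head G e, inv (head G e) \<otimes> tail G e)"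

lemma mult_inv_cancel: "x \<in> V \<Longrightarrow> y \<in> V \<Longrightarrow> x \<otimes> (inv x \<otimes> y) = y"
  by (simp add: m_assoc[symmetric])

lemma inv_mult_cancel: "x \<in> V \<Longrightarrow> y \<in> V \<Longrightarrow> inv x \<otimes> (x \<otimes> y) = y"
  by (simp add: m_assoc[symmetric])

lemma dart_ends:
  assumes "e \<in> E"
  shows "{fst (dart e), fst (dart e) \<otimes> snd (dart e)} = e"
    "{fst (opposite_dart e), fst (opposite_dart e) \<otimes> snd (opposite_dart e)} = e"
  using arc_ends[OF assms] tail_head[OF assms]
  by (simp_all add: dart_def opposite_dart_def mult_inv_cancel insert_commute)

lemma inj_on_dart: "inj_on dart E" "inj_on opposite_dart E"
  by (rule inj_on_inverseI[where g = "\<lambda>d. {fst d, fst d \<otimes> snd d}"], simp add: dart_ends)+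

text \<open>A dart determines its edge, so a common dart would force the tail and the head of one
  edge to coincide.\<close>

lemma dart_disjoint: "dart ` E \<inter> opposite_dart ` E = {}"
proof (rule equals0I, elim IntE imageE)
  fix d e f assume d: "d = dart e" "e \<in> E" "d = opposite_dart f" "f \<in> E"
  have "e = f" using dart_ends(1)[OF d(2)] dart_ends(2)[OF d(4)] d(1,3) by simp
  then show False using d tail_head(3)[OF d(2)] by (simp add: dart_def opposite_dart_def)
qed

lemma dart_union: "dart ` E \<union> opposite_dart ` E = V \<times> S"
proof
  show "dart ` E \<union> opposite_dart ` E \<subseteq> V \<times> S"
    using tail_head by (auto simp: dart_def opposite_dart_def)
  show "V \<times> S \<subseteq> dart ` E \<union> opposite_dart ` E"
  proof clarify
    fix x s assume x: "x \<in> V" "s \<in> S" and n: "(x, s) \<notin> opposite_dart ` E"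
    have e: "{x, x \<otimes> s} \<in> E" using x by (rule arcI)
    then show "(x, s) \<in> dart ` E"
    proof (cases rule: arc_cases)
      case 1
      then have "(x, s) = dart {x, x \<otimes> s}" using x by (simp add: dart_def inv_mult_cancel)
      then show ?thesis using e by (rule image_eqI)
    next
      case 2
      then have "(x, s) = opposite_dart {x, x \<otimes> s}" using x by (simp add: opposite_dart_def inv_mult_cancel)
      then have "(x, s) \<in> opposite_dart ` E" using e by (rule image_eqI)
      then show ?thesis using n by contradiction
    qed
  qed
qed

text \<open>The function \<open>a\<close> may depend on the direction of travel; the two directions
  contribute \<open>A\<close> and \<open>A'\<close>.\<close>

lemma has_sum_darts:
  fixes a :: "'a \<Rightarrow> 'a \<Rightarrow> 'b::topological_comm_monoid_add"
  assumes "((\<lambda>e. a (tail G e) (head G e)) has_sum A) E"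
    and "((\<lambda>e. a (head G e) (tail G e)) has_sum A') E"
  shows "((\<lambda>(x, s). a x (x \<otimes> s)) has_sum (A + A')) (V \<times> S)"
proof -
  have 1: "((\<lambda>(x, s). a x (x \<otimes> s)) has_sum A) (dart ` E)"
    using assms(1) tail_head
    by (subst has_sum_reindex[OF inj_on_dart(1)], subst has_sum_cong[where g = "\<lambda>e. a (tail G e) (head G e)"])
      (auto simp: dart_def mult_inv_cancel)
  have 2: "((\<lambda>(x, s). a x (x \<otimes> s)) has_sum A') (opposite_dart ` E)"
    using assms(2) tail_head
    by (subst has_sum_reindex[OF inj_on_dart(2)], subst has_sum_cong[where g = "\<lambda>e. a (head G e) (tail G e)"])
      (auto simp: opposite_dart_def mult_inv_cancel)
  show ?thesis using has_sum_Un_disjoint[OF 1 2 dart_disjoint] by (simp only: dart_union)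
qed

lemma summable_darts:
  fixes a :: "'a \<Rightarrow> 'a \<Rightarrow> 'b::banach"
  assumes "(\<lambda>(x, s). a x (x \<otimes> s)) summable_on (V \<times> S)"
  shows "(\<lambda>e. a (tail G e) (head G e)) summable_on E"
    and "(\<lambda>e. a (head G e) (tail G e)) summable_on E"
proof -
  have "(\<lambda>(x, s). a x (x \<otimes> s)) summable_on dart ` E"
    by (rule summable_on_subset_banach[OF assms]) (simp add: dart_union[symmetric])
  then show "(\<lambda>e. a (tail G e) (head G e)) summable_on E"
    using tail_head
    by (subst (asm) summable_on_reindex[OF inj_on_dart(1)], subst summable_on_cong)
      (auto simp: dart_def mult_inv_cancel)
  have "(\<lambda>(x, s). a x (x \<otimes> s)) summable_on opposite_dart ` E"
    by (rule summable_on_subset_banach[OF assms]) (simp add: dart_union[symmetric])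
  then show "(\<lambda>e. a (head G e) (tail G e)) summable_on E"
    using tail_head
    by (subst (asm) summable_on_reindex[OF inj_on_dart(2)], subst summable_on_cong)
      (auto simp: opposite_dart_def mult_inv_cancel)
qed

text \<open>The sign in \<open>cv\<close> disappears in the modulus, and every edge is counted once
  from each end; hence the factor 2.\<close>

lemma cv_sq_has_sum:
  assumes "u \<in> l2 E"
  shows "((\<lambda>(x, s). (cmod (cv u x (x \<otimes> s)))\<^sup>2) has_sum (2 * l2_sq E u)) (V \<times> S)"
proof -
  have "((\<lambda>e. (cmod (cv u (tail G e) (head G e)))\<^sup>2) has_sum l2_sq E u) E"
       "((\<lambda>e. (cmod (cv u (head G e) (tail G e)))\<^sup>2) has_sum l2_sq E u) E"
    using l2_sq_has_sum[OF assms] by (auto simp: cv_arc cong: has_sum_cong)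
  from has_sum_darts[OF this] show ?thesis by simp
qed

lemma cv_inner_has_sum:
  assumes "u \<in> l2 E" "w \<in> l2 E"
  shows "((\<lambda>(x, s). cv u x (x \<otimes> s) * cnj (cv w x (x \<otimes> s))) has_sum (2 * l2_inner E u w)) (V \<times> S)"
proof -
  have "((\<lambda>e. cv u (tail G e) (head G e) * cnj (cv w (tail G e) (head G e))) has_sum l2_inner E u w) E"
       "((\<lambda>e. cv u (head G e) (tail G e) * cnj (cv w (head G e) (tail G e))) has_sum l2_inner E u w) E"
    using l2_inner_has_sum[OF assms] by (auto simp: cv_arc cong: has_sum_cong)
  from has_sum_darts[OF this] show ?thesis by simp
qed

section \<open>Divergence as the adjoint of the coboundary map\<close>

text \<open>The boundary map in a form that runs over generators:
  \<open>cv u x (x \<otimes> s)\<close> is the flow from \<open>x\<close> to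
  \<open>x \<otimes> s\<close>, and the minus sign makes the divergence inflow minus
  outflow.\<close>

definition divergence :: "('a set \<Rightarrow> complex) \<Rightarrow> 'a \<Rightarrow> complex" where
  "divergence u x = (if x \<in> V then \<Sum>s\<in>S. - cv u x (x \<otimes> s) else 0)"

lemma cv_l2:
  assumes u: "u \<in> l2 E" and s: "s \<in> S"
  shows "(\<lambda>x. if x \<in> V then cv u x (x \<otimes> s) else 0) \<in> l2 V"
proof -
  have "(\<lambda>(x, s). (cmod (cv u x (x \<otimes> s)))\<^sup>2) summable_on (\<lambda>x. (x, s)) ` V"
    by (rule summable_on_subset_banach[OF has_sum_imp_summable[OF cv_sq_has_sum[OF u]]]) (use s in auto)
  then have "(\<lambda>x. (cmod (cv u x (x \<otimes> s)))\<^sup>2) summable_on V"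
    by (subst (asm) summable_on_reindex) (auto simp: inj_on_def o_def)
  then show ?thesis unfolding l2_def by (auto cong: summable_on_cong)
qed

lemma divergence_eq: "divergence u = (\<lambda>x. - 1 * (\<Sum>s\<in>S. if x \<in> V then cv u x (x \<otimes> s) else 0))"
  by (auto simp: divergence_def fun_eq_iff sum_negf)

lemma divergence_l2: "u \<in> l2 E \<Longrightarrow> divergence u \<in> l2 V"
  unfolding divergence_eq by (intro l2_scale l2_sum finite_S cv_l2)

text \<open>Since \<open>S\<close> is finite, |f x|^2 is summable over all darts
  \<open>(x, s)\<close>, hence over the heads and over the tails of edges.\<close>

lemma coboundary_l2:
  assumes f: "f \<in> l2 V" shows "coboundary G f \<in> l2 E"
proof -
  have *: "(\<lambda>(x, s). (cmod (f x))\<^sup>2) summable_on V \<times> S"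
    using has_sum_times_finite[OF finite_S l2_sq_has_sum[OF f]] by (rule has_sum_imp_summable)
  have "(\<lambda>e. 2 * (cmod (f (head G e)))\<^sup>2 + 2 * (cmod (f (tail G e)))\<^sup>2) summable_on E"
    using summable_darts[of "\<lambda>x y. (cmod (f x))\<^sup>2", OF *]
    by (intro summable_on_add summable_on_cmult_right)
  then have "(\<lambda>e. (cmod (coboundary G f e))\<^sup>2) summable_on E"
  proof (rule summable_on_comparison_test)
    fix e assume "e \<in> E"
    have "(cmod (f (head G e) - f (tail G e)))\<^sup>2 \<le> (cmod (f (head G e)) + cmod (f (tail G e)))\<^sup>2"
      by (intro power_mono norm_triangle_ineq4) simp
    also have "\<dots> \<le> 2 * (cmod (f (head G e)))\<^sup>2 + 2 * (cmod (f (tail G e)))\<^sup>2"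
      using zero_le_power2[of "cmod (f (head G e)) - cmod (f (tail G e))"]
      by (simp add: power2_eq_square algebra_simps)
    finally show "(cmod (coboundary G f e))\<^sup>2 \<le> 2 * (cmod (f (head G e)))\<^sup>2 + 2 * (cmod (f (tail G e)))\<^sup>2"
      using \<open>e \<in> E\<close> by (simp add: coboundary_def)
  qed simp
  then show ?thesis by (simp add: l2_def coboundary_def)
qed

text \<open>Summation by parts. The sum of \<open>cv u x y * cnj (f x)\<close> over all darts is
  computed once by base vertices and once by edges, where the two darts of \<open>e\<close> together
  contribute \<open>- (u e * cnj (coboundary G f e))\<close>.\<close>

lemma inner_coboundary:
  assumes u: "u \<in> l2 E" and f: "f \<in> l2 V"
  shows "l2_inner E u (coboundary G f) = l2_inner V (divergence u) f"
proof -
  let ?u = "\<lambda>s x. if x \<in> V then cv u x (x \<otimes> s) else 0"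
  have "((\<lambda>x. cv u x (x \<otimes> s) * cnj (f x)) has_sum l2_inner V (?u s) f) V" if "s \<in> S" for s
    using l2_inner_has_sum[OF cv_l2[OF u that] f] by (auto cong: has_sum_cong)
  from has_sum_times_finite[OF finite_S this]
  have 1: "((\<lambda>(x, s). cv u x (x \<otimes> s) * cnj (f x)) has_sum (\<Sum>s\<in>S. l2_inner V (?u s) f)) (V \<times> S)" .
  have s: "(\<lambda>e. cv u (tail G e) (head G e) * cnj (f (tail G e))) summable_on E"
       "(\<lambda>e. cv u (head G e) (tail G e) * cnj (f (head G e))) summable_on E"
    by (rule summable_darts[of "\<lambda>x y. cv u x y * cnj (f x)", OF has_sum_imp_summable[OF 1]])+
  have "(\<Sum>s\<in>S. l2_inner V (?u s) f)
      = (\<Sum>\<^sub>\<infinity>e\<in>E. cv u (tail G e) (head G e) * cnj (f (tail G e)))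
      + (\<Sum>\<^sub>\<infinity>e\<in>E. cv u (head G e) (tail G e) * cnj (f (head G e)))"
    using s by (intro has_sum_unique[OF 1 has_sum_darts[of "\<lambda>x y. cv u x y * cnj (f x)"]]) auto
  also have "\<dots> = (\<Sum>\<^sub>\<infinity>e\<in>E. cv u (tail G e) (head G e) * cnj (f (tail G e))
      + cv u (head G e) (tail G e) * cnj (f (head G e)))"
    by (rule infsum_add[OF s, symmetric])
  also have "\<dots> = (\<Sum>\<^sub>\<infinity>e\<in>E. - (u e * cnj (coboundary G f e)))"
    by (intro infsum_cong) (auto simp: cv_arc coboundary_def algebra_simps)
  also have "\<dots> = - l2_inner E u (coboundary G f)"
    unfolding l2_inner_def by (rule infsum_uminus)
  finally have "l2_inner E u (coboundary G f) = - (\<Sum>s\<in>S. l2_inner V (?u s) f)" by simp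
  also have "\<dots> = - l2_inner V (\<lambda>x. \<Sum>s\<in>S. ?u s x) f"
    by (subst l2_inner_sum_left) (auto intro: finite_S cv_l2 u f)
  also have "\<dots> = l2_inner V (divergence u) f"
  proof -
    have l: "(\<lambda>x. \<Sum>s\<in>S. ?u s x) \<in> l2 V" by (intro l2_sum finite_S cv_l2 u)
    show ?thesis unfolding divergence_eq using l2_inner_lin_left[OF l l f, of "-1" 0] by simp
  qed
  finally show ?thesis .
qed

lemma inj_on_star: "x \<in> V \<Longrightarrow> inj_on (\<lambda>s. {x, x \<otimes> s}) S"
  by (auto intro!: inj_onI simp: doubleton_eq_iff)

lemma star_eq: "x \<in> V \<Longrightarrow> {e \<in> E. x \<in> e} = (\<lambda>s. {x, x \<otimes> s}) ` S"
proof (intro equalityI subsetI)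
  fix e assume x: "x \<in> V" and e: "e \<in> {e \<in> E. x \<in> e}"
  then have "e = {tail G e, head G e}" "x \<in> e" using arc_ends by auto
  then obtain y where y: "e = {x, y}" by (metis insert_commute insertE singletonD)
  then have xy: "{x, y} \<in> E" using e by simp
  show "e \<in> (\<lambda>s. {x, x \<otimes> s}) ` S"
    using arc_gen[OF xy] arc_closed[OF xy]
    by (intro image_eqI[where x = "inv x \<otimes> y"]) (simp_all add: y mult_inv_cancel)
qed auto

text \<open>There are no loops, so an edge at \<open>x\<close> is incoming precisely when its tail
  differs from \<open>x\<close>.\<close>

lemma boundary_eq_divergence:
  assumes x: "x \<in> V" shows "boundary G u x = divergence u x"
proof -
  let ?st = "{e \<in> E. x \<in> e}"
  have fin: "finite ?st" unfolding star_eq[OF x] using finite_S by simp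
  have i: "in_arcs G x = {e \<in> ?st. tail G e \<noteq> x}" and o: "out_arcs G x = {e \<in> ?st. tail G e = x}"
  proof -
    have "head G e = x \<longleftrightarrow> x \<in> e \<and> tail G e \<noteq> x" if "e \<in> E" for e
      using mem_arc[OF that, of x] tail_head(3)[OF that] by auto
    moreover have "tail G e = x \<Longrightarrow> x \<in> e" if "e \<in> E" for e
      using mem_arc[OF that] by simp
    ultimately show "in_arcs G x = {e \<in> ?st. tail G e \<noteq> x}" "out_arcs G x = {e \<in> ?st. tail G e = x}"
      by (auto simp: in_arcs_def out_arcs_def)
  qed
  have "divergence u x = (\<Sum>s\<in>S. if tail G {x, x \<otimes> s} = x then - u {x, x \<otimes> s} else u {x, x \<otimes> s})"
    unfolding divergence_def using x by (auto simp: chain_value_def intro!: sum.cong)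
  also have "\<dots> = (\<Sum>e\<in>?st. if tail G e = x then - u e else u e)"
    unfolding star_eq[OF x] by (subst sum.reindex[OF inj_on_star[OF x]]) simp
  also have "\<dots> = (\<Sum>e\<in>out_arcs G x. - u e) + (\<Sum>e\<in>in_arcs G x. u e)"
    unfolding i o using fin by (simp add: sum.If_cases Int_def)
  finally show ?thesis by (simp add: boundary_def sum_negf)
qed

lemma coboundaries_subset: "B \<subseteq> l2 E"
  unfolding l2_coboundaries_def verts_eq using coboundary_l2 by blast

lemma coboundaries_subspace: "l2_subspace E B"
  unfolding l2_subspace_def
proof (intro conjI ballI allI coboundaries_subset)
  have "(\<lambda>e. 0) = coboundary G (\<lambda>x. 0)" by (auto simp: coboundary_def)
  then show "(\<lambda>e. 0) \<in> B" unfolding l2_coboundaries_def using l2_zero by blast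
  fix u w a b assume "u \<in> B" "w \<in> B"
  then obtain f h where fh: "f \<in> l2 V" "h \<in> l2 V" "u = coboundary G f" "w = coboundary G h"
    unfolding l2_coboundaries_def verts_eq by blast
  have "(\<lambda>e. a * u e + b * w e) = coboundary G (\<lambda>x. a * f x + b * h x)"
    unfolding fh by (auto simp: coboundary_def algebra_simps)
  then show "(\<lambda>e. a * u e + b * w e) \<in> B"
    unfolding l2_coboundaries_def verts_eq using l2_lin[OF fh(1,2)] by blast
qed

text \<open>By adjointness; the coboundaries of vertex indicators already detect the divergence at
  each vertex.\<close>

lemma orth_coboundaries_iff: "u \<in> l2_orth E B \<longleftrightarrow> u \<in> l2 E \<and> (\<forall>x\<in>V. divergence u x = 0)"
proof
  assume u: "u \<in> l2_orth E B"
  have "divergence u x = 0" if x: "x \<in> V" for x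
  proof -
    have "coboundary G (indicator {x}) \<in> B"
      unfolding l2_coboundaries_def verts_eq using l2_indicator[OF x] by (rule imageI)
    then have "l2_inner E u (coboundary G (indicator {x})) = 0" by (rule l2_orthD(2)[OF u])
    then show ?thesis
      using inner_coboundary[OF l2_orthD(1)[OF u] l2_indicator[OF x]] l2_inner_indicator[OF x] by simp
  qed
  then show "u \<in> l2 E \<and> (\<forall>x\<in>V. divergence u x = 0)" using l2_orthD(1)[OF u] by blast
next
  assume u: "u \<in> l2 E \<and> (\<forall>x\<in>V. divergence u x = 0)"
  then have d: "divergence u = (\<lambda>x. 0)" by (auto simp: divergence_def)
  have "l2_inner E u (coboundary G f) = 0" if "f \<in> l2 V" for f
    using inner_coboundary[OF _ that, of u] u unfolding d by (simp add: l2_inner_def)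
  then show "u \<in> l2_orth E B"
    using u by (auto simp: l2_orth_def l2_coboundaries_def verts_eq)
qed

text \<open>Finite chains are square-summable, and on \<open>V\<close> the boundary is the
  divergence. In particular \<open>Z\<close> lies in the orthogonal complement of
  \<open>B\<close>.\<close>

lemma cycles_iff: "u \<in> Z \<longleftrightarrow> u \<in> finite_chains G \<and> u \<in> l2_orth E B"
  unfolding orth_coboundaries_iff finite_cycles_def verts_eq
  by (auto simp: boundary_eq_divergence finite_chains_def intro: l2_finite_support)

lemma cycles_subset: "Z \<subseteq> l2 E"
  using cycles_iff l2_orthD(1) by blast

section \<open>Translation of edges and chains by group elements\<close>

definition translate :: "'a \<Rightarrow> 'a set \<Rightarrow> 'a set" where
  "translate \<gamma> e = (\<lambda>x. \<gamma> \<otimes> x) ` e"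

lemma translate_arc:
  assumes \<gamma>: "\<gamma> \<in> V" and e: "e \<in> E"
  shows "translate \<gamma> e \<in> E"
proof -
  have "inv (\<gamma> \<otimes> tail G e) \<otimes> (\<gamma> \<otimes> head G e) = inv (tail G e) \<otimes> head G e"
    using \<gamma> tail_head[OF e] by (simp add: inv_mult_group m_assoc inv_mult_cancel)
  then have "{\<gamma> \<otimes> tail G e, \<gamma> \<otimes> head G e} \<in> E"
    using tail_head[OF e] \<gamma> by (simp add: arc_iff)
  moreover have "translate \<gamma> e = {\<gamma> \<otimes> tail G e, \<gamma> \<otimes> head G e}"
    unfolding translate_def by (subst arc_ends[OF e, symmetric]) simp
  ultimately show ?thesis by simp
qed

lemma translate_inv:
  assumes "\<gamma> \<in> V" "e \<in> E" shows "translate \<gamma> (translate (inv \<gamma>) e) = e" "translate (inv \<gamma>) (translate \<gamma> e) = e"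
proof -
  have "x \<in> V" if "x \<in> e" for x
    using that mem_arc[OF assms(2)] tail_head[OF assms(2)] by auto
  then have "(\<lambda>x. \<gamma> \<otimes> (inv \<gamma> \<otimes> x)) ` e = (\<lambda>x. x) ` e" "(\<lambda>x. inv \<gamma> \<otimes> (\<gamma> \<otimes> x)) ` e = (\<lambda>x. x) ` e"
    using assms(1) by (simp_all add: mult_inv_cancel inv_mult_cancel cong: image_cong_simp)
  then show "translate \<gamma> (translate (inv \<gamma>) e) = e" "translate (inv \<gamma>) (translate \<gamma> e) = e"
    by (auto simp: translate_def image_image)
qed

lemma translate_bij: "\<gamma> \<in> V \<Longrightarrow> bij_betw (translate \<gamma>) E E"
  by (rule bij_betwI[where g = "translate (inv \<gamma>)"]) (auto simp: translate_arc translate_inv)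

lemma arc_translate: "\<gamma> \<in> V \<Longrightarrow> {x, y} \<in> E \<Longrightarrow> {\<gamma> \<otimes> x, \<gamma> \<otimes> y} \<in> E"
  using translate_arc[of \<gamma> "{x, y}"] by (simp add: translate_def)

text \<open>In terms of the antisymmetric values \<open>cv\<close> the signs in \<open>act\<close>
  cancel, and the action is plain left translation.\<close>

lemma cv_act:
  assumes "\<gamma> \<in> V" "{x, y} \<in> E"
  shows "cv (act \<gamma> u) x y = cv u (inv \<gamma> \<otimes> x) (inv \<gamma> \<otimes> y)"
  using assms(2)
proof (cases rule: arc_cases)
  case 1 then show ?thesis using assms arc_neq by (simp add: chain_value_def chain_act_def)
next
  case 2
  then have "cv (act \<gamma> u) x y = - act \<gamma> u {x, y}"
    using arc_neq[OF assms(2)] by (simp add: chain_value_def)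
  also have "\<dots> = - cv u (inv \<gamma> \<otimes> y) (inv \<gamma> \<otimes> x)"
    using 2 assms(2) by (simp add: chain_act_def)
  finally show ?thesis using cv_swap[OF arc_translate[of "inv \<gamma>"], of x y u] assms by simp
qed

text \<open>The sign is the same for \<open>u\<close> and \<open>w\<close>, so it drops out of
  \<open>act \<gamma> u e * cnj (act \<gamma> w e)\<close>; this is what makes the action
  unitary.\<close>

lemma act_arc:
  assumes "e \<in> E"
  shows "act \<gamma> u e = u (translate (inv \<gamma>) e) \<and> act \<gamma> w e = w (translate (inv \<gamma>) e) \<or>
    act \<gamma> u e = - u (translate (inv \<gamma>) e) \<and> act \<gamma> w e = - w (translate (inv \<gamma>) e)"
proof -
  have "translate (inv \<gamma>) e = {inv \<gamma> \<otimes> tail G e, inv \<gamma> \<otimes> head G e}"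
    unfolding translate_def by (subst arc_ends[OF assms, symmetric]) simp
  then show ?thesis using assms by (auto simp: chain_act_def chain_value_def)
qed

lemma cmod_act: "e \<in> E \<Longrightarrow> cmod (act \<gamma> u e) = cmod (u (translate (inv \<gamma>) e))"
  using act_arc[of e \<gamma> u u] by auto

lemma act_l2:
  assumes "\<gamma> \<in> V" "u \<in> l2 E" shows "act \<gamma> u \<in> l2 E"
proof -
  have "(\<lambda>e. (cmod (u (translate (inv \<gamma>) e)))\<^sup>2) summable_on E"
    using summable_on_reindex_bij_betw[OF translate_bij[of "inv \<gamma>"], of "\<lambda>e. (cmod (u e))\<^sup>2"]
      l2_summable[OF assms(2)] assms(1) by simp
  then have "(\<lambda>e. (cmod (act \<gamma> u e))\<^sup>2) summable_on E"
    by (subst summable_on_cong[where g = "\<lambda>e. (cmod (u (translate (inv \<gamma>) e)))\<^sup>2"])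
      (simp_all add: cmod_act)
  then show ?thesis by (simp add: l2_def) (simp add: chain_act_def)
qed

lemma act_inner:
  assumes "\<gamma> \<in> V" shows "l2_inner E (act \<gamma> u) (act \<gamma> w) = l2_inner E u w"
proof -
  have "l2_inner E (act \<gamma> u) (act \<gamma> w)
      = (\<Sum>\<^sub>\<infinity>e\<in>E. u (translate (inv \<gamma>) e) * cnj (w (translate (inv \<gamma>) e)))"
    unfolding l2_inner_def
  proof (rule infsum_cong)
    fix e assume "e \<in> E"
    from act_arc[OF this, of \<gamma> u w]
    show "act \<gamma> u e * cnj (act \<gamma> w e) = u (translate (inv \<gamma>) e) * cnj (w (translate (inv \<gamma>) e))"
      by auto
  qed
  also have "\<dots> = l2_inner E u w"
    unfolding l2_inner_def
    using infsum_reindex_bij_betw[OF translate_bij[of "inv \<gamma>"], of "\<lambda>e. u e * cnj (w e)"] assms by simp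
  finally show ?thesis .
qed

lemma act_act_inv:
  assumes "\<gamma> \<in> V" "u \<in> l2 E" shows "act \<gamma> (act (inv \<gamma>) u) = u"
proof
  fix e
  show "act \<gamma> (act (inv \<gamma>) u) e = u e"
  proof (cases "e \<in> E")
    case True
    note th = tail_head[OF True]
    have e: "{tail G e, head G e} \<in> E" using arc_ends[OF True] True by simp
    have "act \<gamma> (act (inv \<gamma>) u) e = cv (act (inv \<gamma>) u) (inv \<gamma> \<otimes> tail G e) (inv \<gamma> \<otimes> head G e)"
      using True by (simp add: chain_act_def)
    also have "\<dots> = cv u (tail G e) (head G e)"
      using th assms(1) arc_translate[OF _ e, of "inv \<gamma>"] by (simp add: cv_act mult_inv_cancel)
    finally show ?thesis using cv_arc[OF True] by simp
  qed (use assms in \<open>simp add: chain_act_def l2_outside\<close>)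
qed

lemma inner_act_right:
  assumes "\<gamma> \<in> V" "u \<in> l2 E"
  shows "l2_inner E u (act \<gamma> w) = l2_inner E (act (inv \<gamma>) u) w"
  using act_inner[OF assms(1), of "act (inv \<gamma>) u" w] act_act_inv[OF assms] by simp

lemma divergence_act:
  assumes "\<gamma> \<in> V" "x \<in> V" shows "divergence (act \<gamma> u) x = divergence u (inv \<gamma> \<otimes> x)"
  unfolding divergence_def using assms by (auto intro!: sum.cong simp: cv_act arcI m_assoc)

lemma act_cycles:
  assumes "\<gamma> \<in> V" "u \<in> Z" shows "act \<gamma> u \<in> Z"
proof -
  have u: "finite {e. u e \<noteq> 0}" "u \<in> l2 E" "\<forall>x\<in>V. divergence u x = 0"
    using assms(2) by (auto simp: cycles_iff finite_chains_def orth_coboundaries_iff)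
  have "{e. act \<gamma> u e \<noteq> 0} \<subseteq> translate \<gamma> ` {e. u e \<noteq> 0}"
  proof
    fix e assume e: "e \<in> {e. act \<gamma> u e \<noteq> 0}"
    then have "e \<in> E" by (auto simp: chain_act_def split: if_splits)
    then have "u (translate (inv \<gamma>) e) \<noteq> 0" "e = translate \<gamma> (translate (inv \<gamma>) e)"
      using cmod_act[of e \<gamma> u] e translate_inv assms(1) by auto
    then show "e \<in> translate \<gamma> ` {e. u e \<noteq> 0}" by blast
  qed
  then have "finite {e. act \<gamma> u e \<noteq> 0}" using u(1) finite_surj by blast
  moreover have "\<forall>x\<in>V. divergence (act \<gamma> u) x = 0"
    using u(3) assms(1) by (simp add: divergence_act)
  ultimately show ?thesis
    using act_l2[OF assms(1) u(2)]
    by (auto simp: cycles_iff finite_chains_def orth_coboundaries_iff chain_act_def)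
qed

section \<open>The harmonic space\<close>

definition harmonic :: "('a set \<Rightarrow> complex) set" where
  "harmonic = l2_orth E B \<inter> l2_orth E Z"

text \<open>Written as a single orthogonal complement, the harmonic space is closed by
  \<open>l2_orth_closed_subspace\<close>.\<close>

lemma harmonic_eq: "harmonic = l2_orth E (B \<union> Z)"
  by (auto simp: harmonic_def l2_orth_def)

text \<open>Equivariance of the divergence handles the condition on \<open>B\<close>; for
  \<open>Z\<close>, the action is unitary and maps \<open>Z\<close> into itself.\<close>

lemma harmonic_act:
  assumes \<gamma>: "\<gamma> \<in> V" and u: "u \<in> harmonic" shows "act \<gamma> u \<in> harmonic"
proof -
  have ul: "u \<in> l2 E" using u l2_orthD(1) by (auto simp: harmonic_def)
  have "act \<gamma> u \<in> l2_orth E B"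
    using u act_l2[OF \<gamma> ul] \<gamma> by (simp add: harmonic_def orth_coboundaries_iff divergence_act)
  moreover have "l2_inner E (act \<gamma> u) z = 0" if z: "z \<in> Z" for z
  proof -
    have "l2_inner E z (act \<gamma> u) = l2_inner E (act (inv \<gamma>) z) u"
      using inner_act_right[OF \<gamma>] z cycles_subset by blast
    also have "\<dots> = 0"
      using act_cycles[of "inv \<gamma>" z] \<gamma> z u l2_orthD(3) by (auto simp: harmonic_def)
    finally show ?thesis using l2_inner_commute[of E "act \<gamma> u" z] by simp
  qed
  ultimately show ?thesis
    using act_l2[OF \<gamma> ul] by (simp add: harmonic_def l2_orth_def[of _ Z])
qed

lemma harmonic_closed_subspace: "l2_closed_subspace E harmonic"
  unfolding harmonic_eq by (rule l2_orth_closed_subspace) (use coboundaries_subset cycles_subset in blast)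

section \<open>Von Neumann dimension as a sum over the edges at a vertex\<close>

text \<open>The right-hand side does not mention the embedding, which is what makes the von Neumann
  dimension well defined.\<close>

lemma embedding_trace:
  assumes H: "l2_closed_subspace E H" and H_act: "\<And>\<gamma> u. \<gamma> \<in> V \<Longrightarrow> u \<in> H \<Longrightarrow> act \<gamma> u \<in> H"
    and emb: "hilbert_module_embedding \<Gamma> E act H n U" and v: "v \<in> V"
  shows "(\<Sum>k<n. proj_matrix (V \<times> {..<n}) (U ` H) (\<one>, k) (\<one>, k)) =
    complex_of_real ((\<Sum>s\<in>S. l2_sq E (l2_proj E H (indicator {{v, v \<otimes> s}}))) / 2)"
proof -
  interpret H: l2_closed_subspace E H by fact
  define J where "J = V \<times> {..<n}"
  have U: "U ` H \<subseteq> l2 J"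
    and lin: "\<And>u v a b. u \<in> H \<Longrightarrow> v \<in> H \<Longrightarrow> U (\<lambda>i. a * u i + b * v i) = (\<lambda>j. a * U u j + b * U v j)"
    and isom: "\<And>u v. u \<in> H \<Longrightarrow> v \<in> H \<Longrightarrow> l2_inner J (U u) (U v) = l2_inner E u v"
    and equiv: "\<And>\<gamma> u. \<gamma> \<in> V \<Longrightarrow> u \<in> H \<Longrightarrow> U (act \<gamma> u) = left_regular \<Gamma> n \<gamma> (U u)"
    using emb by (auto simp: hilbert_module_embedding_def J_def)
  interpret K: l2_closed_subspace J "U ` H"
    by (rule l2_isometric_image_closed_subspace[OF H U lin isom])
  \<comment> \<open>\<open>b j\<close> is the preimage of the reproducing kernel of the image at
    \<open>j\<close>, so that pairing with it reads off the coordinate \<open>U u j\<close>.\<close>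
  have "\<exists>b. b \<in> H \<and> U b = l2_proj J (U ` H) (indicator {j})" if "j \<in> J" for j
    using K.l2_proj_mem[OF l2_indicator[OF that]] by auto
  then obtain b where bH: "\<And>j. j \<in> J \<Longrightarrow> b j \<in> H"
    and Ub: "\<And>j. j \<in> J \<Longrightarrow> U (b j) = l2_proj J (U ` H) (indicator {j})" by metis
  have bl: "b j \<in> l2 E" if "j \<in> J" for j using H.mem_l2 bH that by blast
  have isom_sq: "l2_sq J (U u) = l2_sq E u" if "u \<in> H" for u
    using isom[OF that that] by (simp add: l2_sq_eq_Re_inner)
  have inner_b: "l2_inner E u (b j) = U u j" if "u \<in> H" "j \<in> J" for u j
    using K.inner_proj_indicator[of "U u" j] isom[OF that(1) bH[OF that(2)]] that Ub by simp
  have diag: "proj_matrix J (U ` H) j j = complex_of_real (l2_sq E (b j))" if "j \<in> J" for j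
    using K.proj_matrix_diag[OF that] isom_sq[OF bH[OF that]] by (simp add: Ub[OF that])
  define c where "c = (\<lambda>e. l2_proj E H (indicator {e}))"
  have cH: "c e \<in> H" if "e \<in> E" for e unfolding c_def by (rule H.l2_proj_mem[OF l2_indicator[OF that]])
  \<comment> \<open>Both numbers are the modulus of the inner product of \<open>b j\<close> and
    \<open>c e\<close>, since \<open>b j\<close> represents the \<open>j\<close>-th coordinate of
    \<open>U\<close> and \<open>c e\<close> represents evaluation at \<open>e\<close>.\<close>
  have Uc: "cmod (U (c e) j) = cmod (b j e)" if "e \<in> E" "j \<in> J" for e j
  proof -
    have "U (c e) j = cnj (l2_inner E (b j) (c e))"
      using inner_b[OF cH[OF that(1)] that(2)] l2_inner_commute by metis
    also have "l2_inner E (b j) (c e) = b j e"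
      unfolding c_def by (rule H.inner_proj_indicator[OF bH[OF that(2)] that(1)])
    finally show ?thesis by simp
  qed
  \<comment> \<open>Both sides lie in \<open>H\<close> and represent the same functional on it,
    since \<open>U\<close> turns \<open>act\<close> into left translation of coordinates.\<close>
  have b_act: "b (\<gamma> \<otimes> x, k) = act \<gamma> (b (x, k))" if \<gamma>: "\<gamma> \<in> V" and x: "x \<in> V" and k: "k < n" for \<gamma> x k
  proof -
    have j: "(x, k) \<in> J" "(\<gamma> \<otimes> x, k) \<in> J" using that by (auto simp: J_def)
    have eq: "l2_inner E u (act \<gamma> (b (x, k))) = l2_inner E u (b (\<gamma> \<otimes> x, k))" if u: "u \<in> H" for u
    proof -
      have "l2_inner E u (act \<gamma> (b (x, k))) = U (act (inv \<gamma>) u) (x, k)"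
        using inner_act_right[OF \<gamma> H.mem_l2[OF u]] inner_b[OF H_act[OF _ u] j(1)] \<gamma> by simp
      also have "\<dots> = U u (\<gamma> \<otimes> x, k)"
        using equiv[OF _ u, of "inv \<gamma>"] \<gamma> x k by (simp add: left_regular_def)
      finally show ?thesis using inner_b[OF u j(2)] by simp
    qed
    let ?d = "\<lambda>e. b (\<gamma> \<otimes> x, k) e - act \<gamma> (b (x, k)) e"
    have d: "?d \<in> H" by (rule l2_subspace_diff[OF H.subspace bH[OF j(2)] H_act[OF \<gamma> bH[OF j(1)]]])
    have "l2_inner E ?d ?d = 0"
      using eq[OF d] H.mem_l2 d bH[OF j(2)] H_act[OF \<gamma> bH[OF j(1)]]
      by (subst l2_inner_diff_right) auto
    then have "?d = (\<lambda>e. 0)" by (intro l2_sq_eq_0[OF H.mem_l2[OF d]]) (simp add: l2_sq_eq_Re_inner)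
    then show ?thesis by (auto simp: fun_eq_iff)
  qed
  have b_sq: "cmod (b (x, k) e) = cmod (b (\<one>, k) (translate (inv x) e))"
    if "x \<in> V" "k < n" "e \<in> E" for x k e
    using b_act[OF that(1) one_closed that(2)] cmod_act[OF that(3)] that(1) by simp
  \<comment> \<open>\<open>R k s\<close> collects the edges of type \<open>s\<close> over all base
    points; the row sums and the column sums are both assembled from these numbers.\<close>
  define R where "R = (\<lambda>k s. \<Sum>\<^sub>\<infinity>y\<in>V. (cmod (b (\<one>, k) {y, y \<otimes> s}))\<^sup>2)"
  have R: "((\<lambda>y. (cmod (b (\<one>, k) {y, y \<otimes> s}))\<^sup>2) has_sum R k s) V" if "k < n" "s \<in> S" for k s
  proof -
    have "(\<one>, k) \<in> J" using that by (simp add: J_def)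
    from l2_summable[OF cv_l2[OF bl[OF this] that(2)]]
    have "(\<lambda>y. (cmod (b (\<one>, k) {y, y \<otimes> s}))\<^sup>2) summable_on V"
      by (simp add: cmod_cv cong: summable_on_cong)
    then show ?thesis unfolding R_def by simp
  qed
  have row: "2 * l2_sq E (b (\<one>, k)) = (\<Sum>s\<in>S. R k s)" if "k < n" for k
  proof -
    have "(\<one>, k) \<in> J" using that by (simp add: J_def)
    from cv_sq_has_sum[OF bl[OF this]] has_sum_times_finite[OF finite_S R[OF that]]
    show ?thesis by (simp add: cmod_cv has_sum_unique)
  qed
  have col: "l2_sq E (c {v, v \<otimes> s}) = (\<Sum>k<n. R k s)" if s: "s \<in> S" for s
  proof -
    let ?e = "{v, v \<otimes> s}"
    have e: "?e \<in> E" using v s by (rule arcI)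
    \<comment> \<open>The mass transport: moving the edge at \<open>v\<close> back by
      \<open>x\<close> gives the edge of type \<open>s\<close> at \<open>inv x \<otimes> v\<close>,
      and this base point runs through \<open>V\<close> exactly once as \<open>x\<close>
      does.\<close>
    have "bij_betw (\<lambda>x. inv x \<otimes> v) V V"
      using v by (intro bij_betwI[where g = "\<lambda>y. v \<otimes> inv y"]) (auto simp: inv_mult_group m_assoc mult_inv_cancel)
    note reindex = has_sum_reindex_bij_betw[OF this]
    have "((\<lambda>x. (cmod (b (x, k) ?e))\<^sup>2) has_sum R k s) V" if k: "k < n" for k
    proof -
      have "((\<lambda>x. (cmod (b (\<one>, k) {inv x \<otimes> v, inv x \<otimes> v \<otimes> s}))\<^sup>2) has_sum R k s) V"
        using reindex[of "\<lambda>y. (cmod (b (\<one>, k) {y, y \<otimes> s}))\<^sup>2"] R[OF k s] by simp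
      moreover have "cmod (b (x, k) ?e) = cmod (b (\<one>, k) {inv x \<otimes> v, inv x \<otimes> v \<otimes> s})" if "x \<in> V" for x
        using b_sq[OF that k e] that v s by (simp add: translate_def m_assoc)
      ultimately show ?thesis by (simp cong: has_sum_cong)
    qed
    then have "((\<lambda>(x, k). (cmod (b (x, k) ?e))\<^sup>2) has_sum (\<Sum>k<n. R k s)) (V \<times> {..<n})"
      by (intro has_sum_times_finite) auto
    then have "((\<lambda>j. (cmod (U (c ?e) j))\<^sup>2) has_sum (\<Sum>k<n. R k s)) J"
      unfolding J_def[symmetric] by (rule has_sum_cong[THEN iffD1, rotated]) (auto simp: Uc[OF e])
    moreover have "((\<lambda>j. (cmod (U (c ?e) j))\<^sup>2) has_sum l2_sq E (c ?e)) J"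
      using l2_sq_has_sum[of "U (c ?e)" J] U cH[OF e] isom_sq[OF cH[OF e]] by auto
    ultimately show ?thesis using has_sum_unique by blast
  qed
  have "(\<Sum>k<n. proj_matrix J (U ` H) (\<one>, k) (\<one>, k)) = complex_of_real (\<Sum>k<n. l2_sq E (b (\<one>, k)))"
    unfolding of_real_sum by (intro sum.cong refl diag) (simp add: J_def)
  also have "(\<Sum>k<n. l2_sq E (b (\<one>, k))) = (\<Sum>k<n. (\<Sum>s\<in>S. R k s) / 2)"
    by (intro sum.cong) (simp_all flip: row)
  also have "\<dots> = (\<Sum>s\<in>S. l2_sq E (c {v, v \<otimes> s})) / 2"
    by (simp add: col sum.swap[of _ S] flip: sum_divide_distrib)
  finally show ?thesis by (simp add: J_def c_def)
qed

text \<open>The \<open>THE\<close> in \<open>vn_dim\<close> presupposes some embedding. Listing the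
  values of a chain on all darts provides one, equivariant by \<open>cv_act\<close>.\<close>

lemma embedding_exists:
  assumes H: "H \<subseteq> l2 E"
  shows "\<exists>n U. hilbert_module_embedding \<Gamma> E act H n U"
proof -
  define n where "n = card S"
  obtain gen where gen: "bij_betw gen {..<n} S"
    using ex_bij_betw_nat_finite[OF finite_S] by (auto simp: n_def atLeast0LessThan)
  have gS: "gen k \<in> S" if "k < n" for k using gen that by (auto simp: bij_betw_def)
  define J where "J = V \<times> {..<n}"
  have bij: "bij_betw (\<lambda>(x, k). (x, gen k)) J (V \<times> S)"
    unfolding J_def using bij_betw_map_prod[OF bij_betw_id gen] by (simp add: map_prod_def)
  \<comment> \<open>Each edge has two darts, so division by the square root of 2 makes the map
    isometric.\<close>
  define U where "U = (\<lambda>u (x, k). if (x, k) \<in> J then cv u x (x \<otimes> gen k) / complex_of_real (sqrt 2) else 0)"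
  have inner: "((\<lambda>j. U u j * cnj (U w j)) has_sum l2_inner E u w) J" if "u \<in> l2 E" "w \<in> l2 E" for u w
  proof -
    have "((\<lambda>(x, s). (cv u x (x \<otimes> s) * cnj (cv w x (x \<otimes> s))) / 2) has_sum (2 * l2_inner E u w / 2)) (V \<times> S)"
      using has_sum_divide_const[OF cv_inner_has_sum[OF that], of 2] by (simp add: case_prod_unfold)
    then have "((\<lambda>(x, k). (cv u x (x \<otimes> gen k) * cnj (cv w x (x \<otimes> gen k))) / 2) has_sum l2_inner E u w) J"
      unfolding has_sum_reindex_bij_betw[OF bij, symmetric] by (simp add: case_prod_unfold)
    moreover have "U u j * cnj (U w j) = (\<lambda>(x, k). (cv u x (x \<otimes> gen k) * cnj (cv w x (x \<otimes> gen k))) / 2) j"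
      if "j \<in> J" for j
      using that by (auto simp: U_def simp flip: of_real_mult split: prod.split)
    ultimately show ?thesis by (subst has_sum_cong) auto
  qed
  have "hilbert_module_embedding \<Gamma> E act H n U"
    unfolding hilbert_module_embedding_def J_def[symmetric]
  proof (intro conjI ballI allI)
    show "U ` H \<subseteq> l2 J"
    proof clarify
      fix u assume "u \<in> H"
      then have "u \<in> l2 E" using H by blast
      from summable_on_Re[OF has_sum_imp_summable[OF inner[OF this this]]]
      have "(\<lambda>j. (cmod (U u j))\<^sup>2) summable_on J"
        by (simp add: cmod_power2 flip: power2_eq_square)
      then show "U u \<in> l2 J" by (auto simp: l2_def U_def)
    qed
  next
    fix u w a b assume "u \<in> H" "w \<in> H"
    show "U (\<lambda>e. a * u e + b * w e) = (\<lambda>j. a * U u j + b * U w j)"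
      by (auto simp: U_def cv_lin add_divide_distrib)
  next
    fix u w assume "u \<in> H" "w \<in> H"
    then show "l2_inner J (U u) (U w) = l2_inner E u w"
      unfolding l2_inner_def[of J] using H inner by (blast intro: infsumI)
  next
    fix \<gamma> u assume "\<gamma> \<in> V" "u \<in> H"
    then show "U (act \<gamma> u) = left_regular \<Gamma> n \<gamma> (U u)"
      by (auto simp: U_def left_regular_def J_def cv_act arcI gS m_assoc)
  qed
  then show ?thesis by blast
qed

text \<open>All embeddings have the same trace by \<open>embedding_trace\<close>, and one exists by
  \<open>embedding_exists\<close>, so the definite description denotes this value.\<close>

lemma vn_dim_eq:
  assumes H: "l2_closed_subspace E H" and H_act: "\<And>\<gamma> u. \<gamma> \<in> V \<Longrightarrow> u \<in> H \<Longrightarrow> act \<gamma> u \<in> H"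
    and v: "v \<in> V"
  shows "vn_dim \<Gamma> E act H = (\<Sum>s\<in>S. l2_sq E (l2_proj E H (indicator {{v, v \<otimes> s}}))) / 2"
  unfolding vn_dim_def
proof (rule the_equality)
  have "H \<subseteq> l2 E" using l2_closed_subspace.mem_l2[OF H] by blast
  then obtain n U where emb: "hilbert_module_embedding \<Gamma> E act H n U" using embedding_exists by blast
  have trace: "complex_of_real ((\<Sum>s\<in>S. l2_sq E (l2_proj E H (indicator {{v, v \<otimes> s}}))) / 2) =
      (\<Sum>k<n. proj_matrix (V \<times> {..<n}) (U ` H) (\<one>, k) (\<one>, k))"
    if "hilbert_module_embedding \<Gamma> E act H n U" for n U
    by (rule embedding_trace[OF H _ that v, symmetric]) (rule H_act)
  show "\<exists>n U. hilbert_module_embedding \<Gamma> E act H n U \<and>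
      complex_of_real ((\<Sum>s\<in>S. l2_sq E (l2_proj E H (indicator {{v, v \<otimes> s}}))) / 2) =
      (\<Sum>k<n. proj_matrix (V \<times> {..<n}) (U ` H) (\<one>, k) (\<one>, k))"
    by (intro exI conjI, rule emb, rule trace[OF emb])
  fix d assume "\<exists>n U. hilbert_module_embedding \<Gamma> E act H n U \<and>
      complex_of_real d = (\<Sum>k<n. proj_matrix (V \<times> {..<n}) (U ` H) (\<one>, k) (\<one>, k))"
  then obtain n' U' where emb': "hilbert_module_embedding \<Gamma> E act H n' U'"
    and d: "complex_of_real d = (\<Sum>k<n'. proj_matrix (V \<times> {..<n'}) (U' ` H) (\<one>, k) (\<one>, k))" by blast
  have "complex_of_real d =
      complex_of_real ((\<Sum>s\<in>S. l2_sq E (l2_proj E H (indicator {{v, v \<otimes> s}}))) / 2)"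
    unfolding d by (rule trace[OF emb', symmetric])
  then show "d = (\<Sum>s\<in>S. l2_sq E (l2_proj E H (indicator {{v, v \<otimes> s}}))) / 2"
    by (simp only: of_real_eq_iff)
qed

section \<open>The projection onto the coboundaries\<close>

text \<open>Terms of the Neumann series for the inverse of \<open>card S + t - A\<close>, where
  \<open>A\<close> sums the right translations by generators, applied to the indicator of the
  identity. The division in step 0 makes the series the inverse itself; a walker dies with
  probability \<open>t / (card S + t)\<close> per step.\<close>

fun walk :: "real \<Rightarrow> nat \<Rightarrow> 'a \<Rightarrow> real" where
  "walk t 0 y = (if y = \<one> then 1 else 0) / (real (card S) + t)"
| "walk t (Suc n) y = (\<Sum>s\<in>S. walk t n (y \<otimes> s)) / (real (card S) + t)"

definition green :: "real \<Rightarrow> 'a \<Rightarrow> real" where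
  "green t y = (\<Sum>n. walk t n y)"

lemma walk_nonneg: "0 < t \<Longrightarrow> 0 \<le> walk t n y"
  by (induction n arbitrary: y) (auto intro!: sum_nonneg divide_nonneg_nonneg)

text \<open>Right translation by \<open>s\<close> permutes \<open>V\<close>, so each step multiplies
  the total mass by \<open>card S / (card S + t)\<close>.\<close>

lemma walk_has_sum:
  assumes t: "0 < t"
  shows "(walk t n has_sum ((real (card S) / (real (card S) + t)) ^ n / (real (card S) + t))) V"
proof (induction n)
  case 0
  have "((\<lambda>y. if y = \<one> then 1 / (real (card S) + t) else 0) has_sum (1 / (real (card S) + t))) {\<one>}"
    by (rule has_sum_finiteI) auto
  then have "((\<lambda>y. if y = \<one> then 1 / (real (card S) + t) else 0) has_sum (1 / (real (card S) + t))) V"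
    by (rule has_sum_cong_neutral[THEN iffD1, rotated -1]) auto
  moreover have "walk t 0 = (\<lambda>y. if y = \<one> then 1 / (real (card S) + t) else 0)" by auto
  ultimately show ?case by simp
next
  case (Suc n)
  let ?c = "real (card S) + t"
  have "((\<lambda>y. walk t n (y \<otimes> s)) has_sum ((real (card S) / ?c) ^ n / ?c)) V" if s: "s \<in> S" for s
  proof -
    have "bij_betw (\<lambda>y. y \<otimes> s) V V"
      using s by (intro bij_betwI[where g = "\<lambda>y. y \<otimes> inv s"]) (auto simp: m_assoc)
    from has_sum_reindex_bij_betw[OF this, of "walk t n"] Suc show ?thesis by simp
  qed
  then have "((\<lambda>y. \<Sum>s\<in>S. walk t n (y \<otimes> s)) has_sum (\<Sum>s\<in>S. (real (card S) / ?c) ^ n / ?c)) V"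
    by (rule has_sum_finite_sum[OF finite_S])
  note sum = has_sum_divide_const[OF this, where c = ?c]
  have "walk t (Suc n) = (\<lambda>y. (\<Sum>s\<in>S. walk t n (y \<otimes> s)) / ?c)" by auto
  with sum show ?case by simp
qed

lemma sum_walk_le:
  assumes t: "0 < t" and F: "finite F" "F \<subseteq> V"
  shows "(\<Sum>y\<in>F. walk t n y) \<le> (real (card S) / (real (card S) + t)) ^ n / (real (card S) + t)"
  using finite_sum_le_has_sum[OF walk_has_sum[OF t] F] walk_nonneg[OF t] by blast

lemma walk_mass_sums:
  assumes t: "0 < t"
  shows "(\<lambda>n. (real (card S) / (real (card S) + t)) ^ n / (real (card S) + t)) sums (1 / t)"
proof -
  have "norm (real (card S) / (real (card S) + t)) < 1" using t by simp
  from sums_divide[OF geometric_sums[OF this], of "real (card S) + t"]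
  have "(\<lambda>n. (real (card S) / (real (card S) + t)) ^ n / (real (card S) + t)) sums (1 / (1 - real (card S) / (real (card S) + t)) / (real (card S) + t))" .
  moreover have "1 - real (card S) / (real (card S) + t) = t / (real (card S) + t)"
    using t by (simp add: diff_divide_eq_iff)
  moreover have "real (card S) + t \<noteq> 0" using t by (smt (verit) of_nat_0_le_iff)
  ultimately show ?thesis by simp
qed

lemma summable_walk:
  assumes t: "0 < t" and y: "y \<in> V" shows "summable (\<lambda>n. walk t n y)"
  using sum_walk_le[OF t, of "{y}"] y walk_nonneg[OF t]
  by (intro summable_comparison_test'[OF sums_summable[OF walk_mass_sums[OF t]], of 0]) auto

lemma green_nonneg: "0 < t \<Longrightarrow> y \<in> V \<Longrightarrow> 0 \<le> green t y"
  unfolding green_def by (intro suminf_nonneg summable_walk walk_nonneg)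

text \<open>The masses of the individual steps form a geometric series with sum
  \<open>1 / t\<close>. For finite \<open>F\<close> only a series and a finite sum are
  interchanged.\<close>

lemma sum_green_le:
  assumes t: "0 < t" and F: "finite F" "F \<subseteq> V"
  shows "(\<Sum>y\<in>F. green t y) \<le> 1 / t"
proof -
  have "(\<Sum>y\<in>F. green t y) = (\<Sum>n. \<Sum>y\<in>F. walk t n y)"
    unfolding green_def using F t by (intro suminf_sum[symmetric] summable_walk) auto
  also have "\<dots> \<le> (\<Sum>n. (real (card S) / (real (card S) + t)) ^ n / (real (card S) + t))"
    using F t by (intro suminf_le sum_walk_le summable_sum summable_walk sums_summable[OF walk_mass_sums]) auto
  also have "\<dots> = 1 / t" using walk_mass_sums[OF t] by (rule sums_unique[symmetric])
  finally show ?thesis .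
qed

lemma green_le: "0 < t \<Longrightarrow> y \<in> V \<Longrightarrow> green t y \<le> 1 / t"
  using sum_green_le[of t "{y}"] by simp

text \<open>The resolvent equation of the Laplacian with pole at the identity: splitting off the
  first term of the series leaves the sum over neighbours.\<close>

lemma green_equation:
  assumes t: "0 < t" and y: "y \<in> V"
  shows "(\<Sum>s\<in>S. green t y - green t (y \<otimes> s)) + t * green t y = (if y = \<one> then 1 else 0)"
proof -
  define c where "c = real (card S) + t"
  have c: "c \<noteq> 0" unfolding c_def using t by (smt (verit) of_nat_0_le_iff)
  have "green t y = walk t 0 y + (\<Sum>n. walk t (Suc n) y)"
    unfolding green_def using suminf_split_head[OF summable_walk[OF t y]] by simp
  also have "(\<Sum>n. walk t (Suc n) y) = (\<Sum>n. \<Sum>s\<in>S. walk t n (y \<otimes> s)) / c"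
    unfolding walk.simps c_def using t y by (intro suminf_divide summable_sum summable_walk) auto
  also have "(\<Sum>n. \<Sum>s\<in>S. walk t n (y \<otimes> s)) = (\<Sum>s\<in>S. green t (y \<otimes> s))"
    unfolding green_def using t y by (intro suminf_sum summable_walk) auto
  finally have "c * green t y = (if y = \<one> then 1 else 0) + (\<Sum>s\<in>S. green t (y \<otimes> s))"
    using c by (simp add: c_def[symmetric] add_divide_distrib[symmetric])
  then show ?thesis by (simp add: c_def sum_subtractf algebra_simps)
qed

definition green_at :: "real \<Rightarrow> 'a \<Rightarrow> 'a \<Rightarrow> complex" where
  "green_at t x y = (if y \<in> V then complex_of_real (green t (inv x \<otimes> y)) else 0)"

text \<open>Values at most \<open>1 / t\<close> and total mass at most \<open>1 / t\<close> bound
  the sum of squares.\<close>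

lemma green_at_l2:
  assumes t: "0 < t" and x: "x \<in> V" shows "green_at t x \<in> l2 V"
proof -
  have "(\<lambda>y. (green t y)\<^sup>2) summable_on V"
  proof (rule nonneg_bdd_above_summable_on)
    show "bdd_above (sum (\<lambda>y. (green t y)\<^sup>2) ` {F. F \<subseteq> V \<and> finite F})"
    proof (rule bdd_aboveI2)
      fix F assume F: "F \<in> {F. F \<subseteq> V \<and> finite F}"
      then have "(\<Sum>y\<in>F. (green t y)\<^sup>2) \<le> (\<Sum>y\<in>F. 1 / t * green t y)"
        using t green_le[OF t] green_nonneg[OF t]
        by (intro sum_mono) (auto simp: power2_eq_square simp del: times_divide_eq_left intro!: mult_right_mono)
      also have "\<dots> = 1 / t * (\<Sum>y\<in>F. green t y)" by (rule sum_distrib_left[symmetric])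
      also have "\<dots> \<le> 1 / t * (1 / t)" using t F by (intro mult_left_mono sum_green_le) auto
      finally show "(\<Sum>y\<in>F. (green t y)\<^sup>2) \<le> 1 / t * (1 / t)" .
    qed
  qed simp
  moreover have "bij_betw (\<lambda>y. inv x \<otimes> y) V V"
    using x by (intro bij_betwI[where g = "\<lambda>y. x \<otimes> y"]) (auto simp: mult_inv_cancel inv_mult_cancel)
  ultimately have "(\<lambda>y. (green t (inv x \<otimes> y))\<^sup>2) summable_on V"
    using summable_on_reindex_bij_betw[of "\<lambda>y. inv x \<otimes> y" V V "\<lambda>y. (green t y)\<^sup>2"] by simp
  then show ?thesis by (simp add: l2_def green_at_def cong: summable_on_cong)
qed

lemma cv_coboundary: "{x, y} \<in> E \<Longrightarrow> cv (coboundary G f) x y = f y - f x"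
  by (frule arc_neq, frule arc_cases) (auto simp: chain_value_def coboundary_def)

lemma divergence_coboundary:
  "x \<in> V \<Longrightarrow> divergence (coboundary G f) x = (\<Sum>s\<in>S. f x - f (x \<otimes> s))"
  by (auto simp: divergence_def cv_coboundary arcI intro!: sum.cong)

text \<open>The weak form of the resolvent equation: \<open>green_at t x\<close> represents
  evaluation at \<open>x\<close> for the form <\<delta> g, \<delta> f> + t <g, f>.\<close>

lemma green_at_equation:
  assumes t: "0 < t" and x: "x \<in> V" and f: "f \<in> l2 V"
  shows "l2_inner E (coboundary G (green_at t x)) (coboundary G f) + t * l2_inner V (green_at t x) f = cnj (f x)"
proof -
  note g = green_at_l2[OF t x]
  note dg = divergence_l2[OF coboundary_l2[OF g]]
  have "1 * divergence (coboundary G (green_at t x)) y + t * green_at t x y = indicator {x} y" for y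
  proof (cases "y \<in> V")
    case True
    then have "divergence (coboundary G (green_at t x)) y + t * green_at t x y
        = complex_of_real ((\<Sum>s\<in>S. green t (inv x \<otimes> y) - green t (inv x \<otimes> y \<otimes> s)) + t * green t (inv x \<otimes> y))"
      using x by (simp add: divergence_coboundary green_at_def m_assoc)
    also have "\<dots> = complex_of_real (if inv x \<otimes> y = \<one> then 1 else 0)"
      using x True t by (simp only: green_equation inv_closed m_closed)
    also have "inv x \<otimes> y = \<one> \<longleftrightarrow> y = x"
      using x True by (metis inv_closed inv_equality inv_inv l_inv)
    finally show ?thesis by (auto simp: indicator_def)
  qed (use x in \<open>auto simp: divergence_def green_at_def indicator_def\<close>)
  then have "(\<lambda>y. 1 * divergence (coboundary G (green_at t x)) y + t * green_at t x y) = indicator {x}" by blast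
  then have "1 * l2_inner V (divergence (coboundary G (green_at t x))) f + t * l2_inner V (green_at t x) f = cnj (f x)"
    unfolding l2_inner_lin_left[OF dg g f, symmetric] by (simp add: l2_inner_indicator_left[OF x])
  then show ?thesis by (simp add: inner_coboundary[OF coboundary_l2[OF g] f])
qed

section \<open>The penalized distance and its minimizer\<close>

text \<open>The voltage produced by a unit source at the head and a unit sink at the tail of
  \<open>e\<close>; it turns out to minimize \<open>energy t e\<close>.\<close>

definition potential :: "real \<Rightarrow> 'a set \<Rightarrow> 'a \<Rightarrow> complex" where
  "potential t e y = green_at t (head G e) y - green_at t (tail G e) y"

text \<open>The coboundary of the potential at \<open>e\<close> itself, written by left invariance
  in terms of a single Green function. For small \<open>t\<close> it approximates the diagonal entry
  of the projection onto the closure of \<open>B\<close>.\<close>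

definition flow :: "real \<Rightarrow> 'a set \<Rightarrow> real" where
  "flow t e = 2 * green t \<one> - green t (inv (tail G e) \<otimes> head G e) - green t (inv (head G e) \<otimes> tail G e)"

lemma coboundary_potential: "e \<in> E \<Longrightarrow> coboundary G (potential t e) e = complex_of_real (flow t e)"
  using tail_head[of e] by (simp add: coboundary_def potential_def green_at_def flow_def)

lemma potential_l2: "0 < t \<Longrightarrow> e \<in> E \<Longrightarrow> potential t e \<in> l2 V"
  unfolding potential_def by (intro l2_diff green_at_l2) (auto simp: tail_head)

text \<open>The Euler--Lagrange equation of the penalized distance, obtained by subtracting the weak
  equations with poles at the head and at the tail.\<close>

lemma potential_equation:
  assumes t: "0 < t" and e: "e \<in> E" and f: "f \<in> l2 V"
  shows "l2_inner E (\<lambda>i. indicator {e} i - coboundary G (potential t e) i) (coboundary G f)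
    = t * l2_inner V (potential t e) f"
proof -
  let ?h = "head G e" and ?t = "tail G e"
  have ht: "?h \<in> V" "?t \<in> V" using tail_head[OF e] by auto
  note g = green_at_l2[OF t ht(1)] green_at_l2[OF t ht(2)]
  note df = coboundary_l2[OF f]
  have "coboundary G (potential t e)
      = (\<lambda>i. coboundary G (green_at t ?h) i - coboundary G (green_at t ?t) i)"
    by (auto simp: coboundary_def potential_def)
  then have "l2_inner E (coboundary G (potential t e)) (coboundary G f)
      = l2_inner E (coboundary G (green_at t ?h)) (coboundary G f)
      - l2_inner E (coboundary G (green_at t ?t)) (coboundary G f)"
    by (simp add: l2_inner_diff_left coboundary_l2 g df)
  moreover have "l2_inner V (potential t e) f = l2_inner V (green_at t ?h) f - l2_inner V (green_at t ?t) f"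
    unfolding potential_def by (rule l2_inner_diff_left[OF g f])
  moreover have "l2_inner E (indicator {e}) (coboundary G f) = cnj (f ?h) - cnj (f ?t)"
    using e by (simp add: l2_inner_indicator_left coboundary_def)
  ultimately show ?thesis
    using green_at_equation[OF t ht(1) f, THEN eq_diff_eq[THEN iffD2]]
      green_at_equation[OF t ht(2) f, THEN eq_diff_eq[THEN iffD2]]
    by (simp add: l2_inner_diff_left[OF l2_indicator[OF e] coboundary_l2[OF potential_l2[OF t e]] df]
        right_diff_distrib)
qed

definition energy :: "real \<Rightarrow> 'a set \<Rightarrow> ('a \<Rightarrow> complex) \<Rightarrow> real" where
  "energy t e f = l2_sq E (\<lambda>i. indicator {e} i - coboundary G f i) + t * l2_sq V f"

text \<open>Testing the Euler--Lagrange equation with the potential itself leaves only the value of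
  the remainder at \<open>e\<close>.\<close>

lemma energy_potential:
  assumes t: "0 < t" and e: "e \<in> E"
  shows "energy t e (potential t e) = 1 - flow t e"
proof -
  let ?p = "potential t e" and ?r = "\<lambda>i. indicator {e} i - coboundary G (potential t e) i"
  have p: "?p \<in> l2 V" by (rule potential_l2[OF t e])
  note dp = coboundary_l2[OF p] and i = l2_indicator[OF e]
  have "l2_inner E ?r ?r = ?r e - l2_inner E ?r (coboundary G ?p)"
    using l2_inner_diff_right[OF i dp l2_diff[OF i dp]] l2_inner_indicator[OF e, of ?r] by simp
  then have "l2_inner E ?r ?r + t * l2_inner V ?p ?p = complex_of_real (1 - flow t e)"
    by (simp add: potential_equation[OF t e p] coboundary_potential[OF e])
  then have "complex_of_real (l2_sq E ?r + t * l2_sq V ?p) = complex_of_real (1 - flow t e)"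
    by (simp add: l2_inner_self)
  then show ?thesis unfolding energy_def of_real_eq_iff .
qed

text \<open>Completing the square around the potential.\<close>

lemma energy_minimal:
  assumes t: "0 < t" and e: "e \<in> E" and f: "f \<in> l2 V"
  shows "1 - flow t e \<le> energy t e f"
proof -
  let ?p = "potential t e" and ?r = "\<lambda>i. indicator {e} i - coboundary G (potential t e) i"
  define h where "h = (\<lambda>y. f y - ?p y)"
  have p: "?p \<in> l2 V" by (rule potential_l2[OF t e])
  have h: "h \<in> l2 V" unfolding h_def by (rule l2_diff[OF f p])
  have r: "?r \<in> l2 E" by (intro l2_diff l2_indicator e coboundary_l2 p)
  have "(\<lambda>i. indicator {e} i - coboundary G f i) = (\<lambda>i. ?r i - coboundary G h i)"
    by (auto simp: h_def coboundary_def)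
  then have 1: "l2_sq E (\<lambda>i. indicator {e} i - coboundary G f i)
      = l2_sq E ?r + l2_sq E (coboundary G h) - 2 * (t * Re (l2_inner V ?p h))"
    using l2_sq_diff[OF r coboundary_l2[OF h]] potential_equation[OF t e h] by simp
  have "f = (\<lambda>y. ?p y + h y)" by (simp add: h_def)
  then have 2: "l2_sq V f = l2_sq V ?p + l2_sq V h + 2 * Re (l2_inner V ?p h)"
    using l2_sq_add[OF p h] by simp
  \<comment> \<open>The cross terms of the two expansions are -2t and 2t times the same real part
    and cancel.\<close>
  have "energy t e f = energy t e ?p + l2_sq E (coboundary G h) + t * l2_sq V h"
    unfolding energy_def 1 2 by (simp add: algebra_simps)
  then show ?thesis
    using t l2_sq_nonneg[of E "coboundary G h"] l2_sq_nonneg[of V h] by (simp add: energy_potential[OF t e])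
qed

section \<open>Letting the penalty tend to 0\<close>

text \<open>One minus the squared norm of this vector is the diagonal entry for the closure of
  \<open>B\<close>. Projecting onto the complement, which is closed, avoids forming that
  closure.\<close>

definition divergence_free_part :: "'a set \<Rightarrow> 'a set \<Rightarrow> complex" where
  "divergence_free_part e = l2_proj E (l2_orth E B) (indicator {e})"

text \<open>Subtracting a coboundary does not change the pairing with the divergence-free part, so
  its pairing with the remainder is its own squared norm; Cauchy--Schwarz concludes.\<close>

lemma divergence_free_part_minimal:
  assumes e: "e \<in> E" and f: "f \<in> l2 V"
  shows "l2_sq E (divergence_free_part e) \<le> l2_sq E (\<lambda>i. indicator {e} i - coboundary G f i)"
proof -
  interpret l2_closed_subspace E "l2_orth E B" by (rule l2_orth_closed_subspace[OF coboundaries_subset])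
  let ?r = "divergence_free_part e" and ?u = "\<lambda>i. indicator {e} i - coboundary G f i"
  have r: "?r \<in> l2_orth E B" unfolding divergence_free_part_def by (rule l2_proj_mem[OF l2_indicator[OF e]])
  have u: "?u \<in> l2 E" by (intro l2_diff l2_indicator e coboundary_l2 f)
  have "coboundary G f \<in> B" unfolding l2_coboundaries_def verts_eq using f by (rule imageI)
  then have "l2_inner E ?r ?u = ?r e"
    using l2_inner_diff_right[OF l2_indicator[OF e] coboundary_l2[OF f] l2_orthD(1)[OF r]] l2_orthD(2)[OF r]
    by (simp add: l2_inner_indicator[OF e])
  also have "?r e = l2_inner E ?r ?r"
    using inner_proj_indicator[OF r e] by (simp add: divergence_free_part_def)
  finally have "(l2_sq E ?r)\<^sup>2 \<le> l2_sq E ?r * l2_sq E ?u"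
    using l2_Cauchy_Schwarz[OF l2_orthD(1)[OF r] u] by (simp add: l2_inner_self)
  then show ?thesis
    using l2_sq_nonneg[of E ?r] l2_sq_nonneg[of E ?u] by (cases "l2_sq E ?r = 0") (auto simp: power2_eq_square)
qed

text \<open>For coboundaries \<open>b n\<close> converging to the projection \<open>w\<close>, the
  squared distance splits by Pythagoras into that of the divergence-free part and that of
  \<open>b n - w\<close>.\<close>

lemma divergence_free_part_approx:
  assumes e: "e \<in> E" and r: "0 < r"
  obtains f where "f \<in> l2 V" "l2_sq E (\<lambda>i. indicator {e} i - coboundary G f i) < l2_sq E (divergence_free_part e) + r"
proof -
  have i: "indicator {e} \<in> l2 E" by (rule l2_indicator[OF e])
  obtain w b where b: "\<And>n::nat. b n \<in> B" and w: "w \<in> l2 E"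
    and lim: "(\<lambda>n. l2_sq E (\<lambda>i. b n i - w i)) \<longlonglongrightarrow> 0"
    and orth: "(\<lambda>i. indicator {e} i - w i) \<in> l2_orth E B"
    using l2_approximate_projection[OF coboundaries_subspace i] by blast
  have bl: "b n \<in> l2 E" for n using b coboundaries_subset by blast
  \<comment> \<open>As a limit of elements of \<open>B\<close>, the vector \<open>w\<close> is
    orthogonal to the complement of \<open>B\<close>; hence the remainder is the projection onto
    that complement.\<close>
  have wz: "l2_inner E w z = 0" if z: "z \<in> l2_orth E B" for z
  proof -
    have "(\<lambda>n. l2_inner E (b n) z) \<longlonglongrightarrow> l2_inner E w z"
      by (rule l2_inner_tendsto[OF bl w l2_orthD(1)[OF z] lim])
    then show ?thesis using l2_orthD(3)[OF z b] by (simp add: LIMSEQ_const_iff)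
  qed
  let ?c = "\<lambda>i. indicator {e} i - w i"
  have c: "divergence_free_part e = ?c"
    unfolding divergence_free_part_def
    by (rule l2_proj_eqI[OF l2_orth_subspace[OF coboundaries_subset] orth])
      (use w wz in \<open>simp add: l2_orth_def\<close>)
  from order_tendstoD(2)[OF lim r] obtain n where n: "l2_sq E (\<lambda>i. b n i - w i) < r"
    by (auto simp: eventually_sequentially)
  obtain f where f: "f \<in> l2 V" "b n = coboundary G f"
    using b[of n] unfolding l2_coboundaries_def verts_eq by blast
  have bw: "(\<lambda>i. b n i - w i) \<in> l2 E" by (rule l2_diff[OF bl w])
  have "l2_inner E ?c (\<lambda>i. b n i - w i) = 0"
    using l2_inner_diff_right[OF bl w l2_orthD(1)[OF orth], of n] l2_orthD(2)[OF orth b]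
      wz[OF orth] l2_inner_commute[of E ?c w] by simp
  then have "l2_sq E (\<lambda>i. ?c i - (b n i - w i)) = l2_sq E ?c + l2_sq E (\<lambda>i. b n i - w i)"
    using l2_sq_diff[OF l2_orthD(1)[OF orth] bw] by simp
  then have "l2_sq E (\<lambda>i. indicator {e} i - coboundary G f i) < l2_sq E (divergence_free_part e) + r"
    using n by (simp add: c f(2))
  then show thesis using that f(1) by blast
qed

text \<open>\<open>1 - flow t e\<close> is the minimal energy, hence at least the unpenalized
  infimum. From above it is compared with one fixed almost optimal \<open>f\<close>, whose penalty
  \<open>t * l2_sq V f\<close> vanishes with \<open>t\<close>.\<close>

lemma flow_tendsto:
  assumes e: "e \<in> E"
  shows "(\<lambda>n. 1 - flow (inverse (real (Suc n))) e) \<longlonglongrightarrow> l2_sq E (divergence_free_part e)"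
proof (rule LIMSEQ_I)
  fix r :: real assume r: "0 < r"
  then have "0 < r / 2" by simp
  then obtain f where f: "f \<in> l2 V"
    and fr: "l2_sq E (\<lambda>i. indicator {e} i - coboundary G f i) < l2_sq E (divergence_free_part e) + r / 2"
    using divergence_free_part_approx[OF e] by blast
  have "(\<lambda>n. inverse (real (Suc n)) * l2_sq V f) \<longlonglongrightarrow> 0 * l2_sq V f"
    by (intro tendsto_mult LIMSEQ_inverse_real_of_nat tendsto_const)
  then have "\<forall>\<^sub>F n in sequentially. inverse (real (Suc n)) * l2_sq V f < r / 2"
    using r by (intro order_tendstoD(2)) auto
  then obtain N where N: "\<And>n. n \<ge> N \<Longrightarrow> inverse (real (Suc n)) * l2_sq V f < r / 2"
    by (auto simp: eventually_sequentially)
  have "norm (1 - flow (inverse (real (Suc n))) e - l2_sq E (divergence_free_part e)) < r" if n: "n \<ge> N" for n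
  proof -
    let ?t = "inverse (real (Suc n))"
    have t: "0 < ?t" by simp
    have p: "potential ?t e \<in> l2 V" by (rule potential_l2[OF t e])
    have "1 - flow ?t e < l2_sq E (divergence_free_part e) + r"
      using energy_minimal[OF t e f] N[OF n] fr unfolding energy_def by linarith
    moreover have "0 \<le> ?t * l2_sq V (potential ?t e)" by (intro mult_nonneg_nonneg l2_sq_nonneg) simp
    then have "l2_sq E (divergence_free_part e) \<le> 1 - flow ?t e"
      using divergence_free_part_minimal[OF e p] unfolding energy_potential[OF t e, symmetric] energy_def by linarith
    ultimately show ?thesis by simp
  qed
  then show "\<exists>no. \<forall>n\<ge>no. norm (1 - flow (inverse (real (Suc n))) e - l2_sq E (divergence_free_part e)) < r" by blast
qed

lemma flow_arc:
  assumes "x \<in> V" "s \<in> S"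
  shows "flow t {x, x \<otimes> s} = 2 * green t \<one> - green t s - green t (inv s)"
proof -
  have "{x, x \<otimes> s} \<in> E" using assms by (rule arcI)
  then show ?thesis
    using assms by (cases rule: arc_cases) (simp_all add: flow_def inv_mult_cancel inv_mult_group m_assoc)
qed

text \<open>Inversion permutes \<open>S\<close>, so both Green terms give the same sum, which the
  resolvent equation at the identity evaluates.\<close>

lemma sum_flow:
  assumes t: "0 < t" and x: "x \<in> V"
  shows "(\<Sum>s\<in>S. flow t {x, x \<otimes> s}) = 2 - 2 * (t * green t \<one>)"
proof -
  have "bij_betw (\<lambda>s. inv s) S S"
    by (rule bij_betwI[where g = "\<lambda>s. inv s"]) (auto simp: inv_S)
  then have "(\<Sum>s\<in>S. green t (inv s)) = (\<Sum>s\<in>S. green t s)" by (rule sum.reindex_bij_betw)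
  moreover have "(\<Sum>s\<in>S. green t \<one> - green t s) = 1 - t * green t \<one>"
    using green_equation[OF t one_closed] by simp
  ultimately show ?thesis
    by (simp add: flow_arc[OF x] sum_subtractf)
qed

section \<open>The Green function at the identity for small killing rates\<close>

text \<open>Testing the weak equation with the Green function itself bounds the squared norm of its
  coboundary by \<open>green t \<one>\<close>, hence by \<open>1 / t\<close>; the factor
  \<open>t\<^sup>2\<close> turns this into the bound \<open>t\<close>.\<close>

lemma green_step:
  assumes t: "0 < t" and y: "y \<in> V" and s: "s \<in> S"
  shows "\<bar>t * green t (y \<otimes> s) - t * green t y\<bar> \<le> sqrt t"
proof -
  let ?g = "green_at t \<one>"
  have g: "?g \<in> l2 V" by (rule green_at_l2[OF t one_closed])
  have "complex_of_real (l2_sq E (coboundary G ?g) + t * l2_sq V ?g) = complex_of_real (green t \<one>)"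
    using green_at_equation[OF t one_closed g] by (simp add: l2_inner_self green_at_def)
  then have "l2_sq E (coboundary G ?g) + t * l2_sq V ?g = green t \<one>" by (simp only: of_real_eq_iff)
  moreover have "0 \<le> t * l2_sq V ?g" using t by (intro mult_nonneg_nonneg l2_sq_nonneg) simp
  ultimately have sq: "l2_sq E (coboundary G ?g) \<le> 1 / t" using green_le[OF t one_closed] by linarith
  have "{y, y \<otimes> s} \<in> E" using y s by (rule arcI)
  from cv_coboundary[OF this, of ?g]
  have "cmod (coboundary G ?g {y, y \<otimes> s}) = \<bar>green t (y \<otimes> s) - green t y\<bar>"
    unfolding cmod_cv[symmetric] using y s by (simp add: green_at_def flip: of_real_diff)
  then have "(green t (y \<otimes> s) - green t y)\<^sup>2 \<le> 1 / t"
    using l2_component_le[OF coboundary_l2[OF g], of "{y, y \<otimes> s}"] sq by simp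
  then have "t\<^sup>2 * (green t (y \<otimes> s) - green t y)\<^sup>2 \<le> t\<^sup>2 * (1 / t)"
    by (rule mult_left_mono) simp
  then have "(t * green t (y \<otimes> s) - t * green t y)\<^sup>2 \<le> t"
    using t by (simp add: power2_eq_square algebra_simps)
  then show ?thesis by (metis real_sqrt_abs real_sqrt_le_iff)
qed

text \<open>Triangle inequality along a word in the generators. The constant depends on
  \<open>x\<close> only and is uniform in \<open>t\<close> and \<open>y\<close>.\<close>

lemma green_oscillation:
  assumes "x \<in> V"
  shows "\<exists>L. \<forall>t>0. \<forall>y\<in>V. \<bar>t * green t (y \<otimes> x) - t * green t y\<bar> \<le> L * sqrt t"
proof -
  have "x \<in> generate \<Gamma> S" using assms generate_S by simp
  then show ?thesis
  proof (induction x rule: generate.induct)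
    case one
    then show ?case by (intro exI[of _ 0]) simp
  next
    case (incl s)
    then show ?case using green_step by (intro exI[of _ 1]) simp
  next
    case (inv s)
    then show ?case using green_step[OF _ _ inv_S] by (intro exI[of _ 1]) simp
  next
    case (eng a b)
    have ab: "a \<in> V" "b \<in> V" using eng.hyps generate_S by auto
    from eng.IH obtain L M
      where L: "\<forall>t>0. \<forall>y\<in>V. \<bar>t * green t (y \<otimes> a) - t * green t y\<bar> \<le> L * sqrt t"
      and M: "\<forall>t>0. \<forall>y\<in>V. \<bar>t * green t (y \<otimes> b) - t * green t y\<bar> \<le> M * sqrt t" by blast
    have "\<bar>t * green t (y \<otimes> (a \<otimes> b)) - t * green t y\<bar> \<le> (L + M) * sqrt t" if "0 < t" "y \<in> V" for t y
    proof -
      have "\<bar>t * green t (y \<otimes> a \<otimes> b) - t * green t (y \<otimes> a)\<bar> \<le> M * sqrt t"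
        "\<bar>t * green t (y \<otimes> a) - t * green t y\<bar> \<le> L * sqrt t"
        using L M that ab by auto
      then show ?thesis using that ab by (simp add: m_assoc distrib_right)
    qed
    then show ?case by blast
  qed
qed

text \<open>An infinite group offers arbitrarily many points. At \<open>Suc N\<close> of them
  \<open>t * green t\<close> is nearly as large as at the identity, while its values there sum to at
  most 1.\<close>

lemma green_tendsto_0: "(\<lambda>n. inverse (real (Suc n)) * green (inverse (real (Suc n))) \<one>) \<longlonglongrightarrow> 0"
proof (rule LIMSEQ_I)
  fix r :: real assume r: "0 < r"
  obtain N where N: "inverse (real (Suc N)) < r / 2" using reals_Archimedean[of "r / 2"] r by auto
  obtain F where F: "F \<subseteq> V" "finite F" "card F = Suc N"
    using infinite_arbitrarily_large[OF infinite_carrier] by blast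
  have "\<forall>x\<in>F. \<exists>L. \<forall>t>0. \<forall>y\<in>V. \<bar>t * green t (y \<otimes> x) - t * green t y\<bar> \<le> L * sqrt t"
    using green_oscillation F(1) by blast
  then obtain L where L: "\<forall>x\<in>F. \<forall>t>0. \<forall>y\<in>V. \<bar>t * green t (y \<otimes> x) - t * green t y\<bar> \<le> L x * sqrt t"
    by metis
  \<comment> \<open>Averaging over the points of \<open>F\<close> turns the sum of the oscillation
    constants into \<open>C\<close>.\<close>
  define C where "C = (\<Sum>x\<in>F. L x) / real (Suc N)"
  have bound: "t * green t \<one> \<le> inverse (real (Suc N)) + C * sqrt t" if t: "0 < t" for t
  proof -
    have "(\<Sum>x\<in>F. t * green t \<one>) \<le> (\<Sum>x\<in>F. t * green t x + L x * sqrt t)"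
    proof (rule sum_mono)
      fix x assume x: "x \<in> F"
      then have "\<bar>t * green t (\<one> \<otimes> x) - t * green t \<one>\<bar> \<le> L x * sqrt t" using L t by blast
      then show "t * green t \<one> \<le> t * green t x + L x * sqrt t" using x F(1) by (simp add: subset_iff)
    qed
    also have "\<dots> = t * (\<Sum>x\<in>F. green t x) + (\<Sum>x\<in>F. L x) * sqrt t"
      by (simp add: sum.distrib sum_distrib_left sum_distrib_right)
    also have "\<dots> \<le> 1 + (\<Sum>x\<in>F. L x) * sqrt t"
      using mult_left_mono[OF sum_green_le[OF t F(2,1)], of t] t by simp
    finally have "real (Suc N) * (t * green t \<one>) \<le> 1 + (\<Sum>x\<in>F. L x) * sqrt t" by (simp add: F(3))
    then have "t * green t \<one> \<le> (1 + (\<Sum>x\<in>F. L x) * sqrt t) / real (Suc N)"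
      by (subst pos_le_divide_eq) (simp_all add: mult.commute)
    then show ?thesis by (simp add: C_def add_divide_distrib inverse_eq_divide)
  qed
  have "(\<lambda>n. C * sqrt (inverse (real (Suc n)))) \<longlonglongrightarrow> C * sqrt 0"
    by (intro tendsto_intros LIMSEQ_inverse_real_of_nat)
  then have "\<forall>\<^sub>F n in sequentially. C * sqrt (inverse (real (Suc n))) < r / 2"
    using r by (intro order_tendstoD(2)) auto
  then obtain M where M: "\<And>n. n \<ge> M \<Longrightarrow> C * sqrt (inverse (real (Suc n))) < r / 2"
    by (auto simp: eventually_sequentially)
  have "norm (inverse (real (Suc n)) * green (inverse (real (Suc n))) \<one> - 0) < r" if "n \<ge> M" for n
  proof -
    let ?t = "inverse (real (Suc n))"
    have t: "0 < ?t" by simp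
    have "0 \<le> ?t * green ?t \<one>" using green_nonneg[OF t one_closed] by (intro mult_nonneg_nonneg) auto
    moreover have "?t * green ?t \<one> < r" using bound[OF t] M[OF that] N by linarith
    ultimately show ?thesis by simp
  qed
  then show "\<exists>no. \<forall>n\<ge>no. norm (inverse (real (Suc n)) * green (inverse (real (Suc n))) \<one> - 0) < r" by blast
qed

lemma sum_divergence_free_part:
  assumes x: "x \<in> V"
  shows "(\<Sum>s\<in>S. 1 - l2_sq E (divergence_free_part {x, x \<otimes> s})) = 2"
proof (rule LIMSEQ_unique)
  show "(\<lambda>n. \<Sum>s\<in>S. 1 - (1 - flow (inverse (real (Suc n))) {x, x \<otimes> s}))
      \<longlonglongrightarrow> (\<Sum>s\<in>S. 1 - l2_sq E (divergence_free_part {x, x \<otimes> s}))"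
    using x by (intro tendsto_sum tendsto_diff tendsto_const flow_tendsto arcI)
  have "(\<lambda>n. 2 - 2 * (inverse (real (Suc n)) * green (inverse (real (Suc n))) \<one>)) \<longlonglongrightarrow> 2 - 2 * 0"
    by (intro tendsto_diff tendsto_mult[OF tendsto_const] tendsto_const green_tendsto_0)
  then show "(\<lambda>n. \<Sum>s\<in>S. 1 - (1 - flow (inverse (real (Suc n))) {x, x \<otimes> s})) \<longlonglongrightarrow> 2"
    using sum_flow[OF _ x] by simp
qed

section \<open>The expected degree\<close>

text \<open>The closure of \<open>B\<close> enters as the double complement of \<open>B\<close>, so
  the splitting of the complement of \<open>Z\<close> uses only projections onto closed
  complements.\<close>

lemma proj_matrix_cycles_orth:
  assumes e: "e \<in> E"
  shows "proj_matrix E (l2_orth E Z) e e =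
    complex_of_real (l2_sq E (l2_proj E harmonic (indicator {e})) + (1 - l2_sq E (divergence_free_part e)))"
proof -
  interpret B: l2_closed_subspace E "l2_orth E B" by (rule l2_orth_closed_subspace[OF coboundaries_subset])
  interpret Z: l2_closed_subspace E "l2_orth E Z" by (rule l2_orth_closed_subspace[OF cycles_subset])
  interpret H: l2_closed_subspace E harmonic by (rule harmonic_closed_subspace)
  have i: "indicator {e} \<in> l2 E" by (rule l2_indicator[OF e])
  define h where "h = l2_proj E harmonic (indicator {e})"
  define r where "r = divergence_free_part e"
  \<comment> \<open>The candidate for the projection: the harmonic part plus the part in the closure
    of \<open>B\<close>.\<close>
  define p where "p = (\<lambda>x. h x + (indicator {e} x - r x))"
  have h: "h \<in> harmonic" "(\<lambda>x. indicator {e} x - h x) \<in> l2_orth E harmonic"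
    unfolding h_def by (rule H.l2_proj_mem[OF i], rule H.l2_proj_orth[OF i])
  have r: "r \<in> l2_orth E B" "(\<lambda>x. indicator {e} x - r x) \<in> l2_orth E (l2_orth E B)"
    unfolding r_def divergence_free_part_def by (rule B.l2_proj_mem[OF i], rule B.l2_proj_orth[OF i])
  have hB: "h \<in> l2_orth E B" and hZ: "h \<in> l2_orth E Z" using h(1) by (auto simp: harmonic_def)
  \<comment> \<open>\<open>Z\<close> is contained in the complement of \<open>B\<close>, and
    complements reverse inclusions.\<close>
  have BB_Z: "w \<in> l2_orth E Z" if "w \<in> l2_orth E (l2_orth E B)" for w
    using that cycles_iff by (auto simp: l2_orth_def[of _ Z] l2_orth_def[of _ "l2_orth E B"])
  note hl = H.mem_l2[OF h(1)] and rl = B.mem_l2[OF r(1)]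
  have "p \<in> l2_orth E Z"
    using l2_subspaceD(3)[OF Z.subspace hZ BB_Z[OF r(2)], of 1 1] by (simp add: p_def)
  moreover have "(\<lambda>x. indicator {e} x - p x) \<in> l2_orth E (l2_orth E Z)"
  proof -
    have eq: "(\<lambda>x. indicator {e} x - p x) = (\<lambda>x. r x - h x)" by (simp add: p_def algebra_simps)
    have rh: "(\<lambda>x. r x - h x) \<in> l2_orth E B" by (rule l2_subspace_diff[OF B.subspace r(1) hB])
    have "l2_inner E (\<lambda>x. r x - h x) w = 0" if w: "w \<in> l2_orth E Z" for w
    proof -
      have wl: "w \<in> l2 E" by (rule Z.mem_l2[OF w])
      \<comment> \<open>The part \<open>w2\<close> lies in the double complement of
        \<open>B\<close>, to which \<open>r - h\<close> is orthogonal. The part \<open>w1\<close> is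
        harmonic, and there \<open>r\<close> and \<open>h\<close> both have the same pairing as
        \<open>indicator {e}\<close>.\<close>
      define w1 where "w1 = l2_proj E (l2_orth E B) w"
      define w2 where "w2 = (\<lambda>x. w x - w1 x)"
      have w1: "w1 \<in> l2_orth E B" unfolding w1_def by (rule B.l2_proj_mem[OF wl])
      have w2: "w2 \<in> l2_orth E (l2_orth E B)" unfolding w1_def w2_def by (rule B.l2_proj_orth[OF wl])
      have w12: "w = (\<lambda>x. w1 x + w2 x)" by (simp add: w2_def)
      have "(\<lambda>x. w x - w2 x) \<in> l2_orth E Z" by (rule l2_subspace_diff[OF Z.subspace w BB_Z[OF w2]])
      then have "w1 \<in> harmonic" using w1 by (simp add: w2_def harmonic_def)
      then have "l2_inner E (indicator {e}) w1 = l2_inner E h w1"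
        using l2_orthD(2)[OF h(2), of w1] l2_inner_diff_left[OF i hl B.mem_l2[OF w1]] by simp
      moreover have "l2_inner E (indicator {e}) w1 = l2_inner E r w1"
        using l2_orthD(2)[OF r(2) w1] l2_inner_diff_left[OF i rl B.mem_l2[OF w1]] by simp
      ultimately have "l2_inner E (\<lambda>x. r x - h x) w1 = 0"
        by (simp add: l2_inner_diff_left[OF rl hl B.mem_l2[OF w1]])
      moreover have "l2_inner E (\<lambda>x. r x - h x) w2 = 0" by (rule l2_orthD(3)[OF w2 rh])
      ultimately show ?thesis
        using l2_inner_add_right[OF B.mem_l2[OF w1] l2_orthD(1)[OF w2] B.mem_l2[OF rh]]
        by (simp add: w12[symmetric])
    qed
    then show ?thesis unfolding eq using B.mem_l2[OF rh] by (simp add: l2_orth_def[of _ "l2_orth E Z"])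
  qed
  ultimately have "l2_proj E (l2_orth E Z) (indicator {e}) = p" by (rule l2_proj_eqI[OF Z.subspace])
  then have "proj_matrix E (l2_orth E Z) e e = h e + (1 - r e)"
    by (simp add: proj_matrix_def l2_inner_indicator[OF e] p_def)
  also have "h e = complex_of_real (l2_sq E h)"
    using H.inner_proj_indicator[OF h(1) e] by (simp add: h_def l2_inner_self)
  also have "r e = complex_of_real (l2_sq E r)"
    using B.inner_proj_indicator[OF r(1) e] by (simp add: r_def divergence_free_part_def l2_inner_self)
  finally show ?thesis by (simp add: h_def r_def)
qed

text \<open>The edges at \<open>v\<close> are enumerated by the generators. In the sum of their
  intensities the harmonic terms give twice the Betti number and the remaining terms give 2.\<close>

lemma expected_degree:
  assumes v: "v \<in> V" and M: "free_uniform_spanning_forest G M"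
  shows "(\<integral>F. real (card {e \<in> F. v \<in> e}) \<partial>M) = 2 * first_l2_betti \<Gamma> G + 2"
proof -
  let ?T = "(\<lambda>s. {v, v \<otimes> s}) ` S"
  let ?h = "\<lambda>e. l2_sq E (l2_proj E harmonic (indicator {e}))"
  note D = M[unfolded free_uniform_spanning_forest_def]
  have card: "(\<integral>F. real (card {e \<in> F. v \<in> e}) \<partial>M) = (\<integral>F. real (card (F \<inter> ?T)) \<partial>M)"
  proof (rule Bochner_Integration.integral_cong[OF refl])
    fix F assume "F \<in> space M"
    then have "F \<subseteq> E" using D by (simp add: determinantal_measure_def)
    then have "{e \<in> F. v \<in> e} = F \<inter> {e \<in> E. v \<in> e}" by blast
    also have "\<dots> = F \<inter> ?T" by (simp only: star_eq[OF v])
    finally have "{e \<in> F. v \<in> e} = F \<inter> ?T" .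
    then show "real (card {e \<in> F. v \<in> e}) = real (card (F \<inter> ?T))" by simp
  qed
  have "complex_of_real (\<integral>F. real (card (F \<inter> ?T)) \<partial>M)
      = (\<Sum>e\<in>?T. proj_matrix E (l2_orth E Z) e e)"
    using finite_S v by (intro determinantal_measure_integral_card[OF D]) auto
  also have "\<dots> = complex_of_real (\<Sum>s\<in>S. ?h {v, v \<otimes> s} + (1 - l2_sq E (divergence_free_part {v, v \<otimes> s})))"
    unfolding sum.reindex[OF inj_on_star[OF v]] o_def of_real_sum
    by (intro sum.cong refl proj_matrix_cycles_orth arcI v)
  finally have "(\<integral>F. real (card (F \<inter> ?T)) \<partial>M)
      = (\<Sum>s\<in>S. ?h {v, v \<otimes> s} + (1 - l2_sq E (divergence_free_part {v, v \<otimes> s})))"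
    by (simp only: of_real_eq_iff)
  also have "\<dots> = (\<Sum>s\<in>S. ?h {v, v \<otimes> s}) + 2"
    unfolding sum.distrib sum_divergence_free_part[OF v] ..
  also have "(\<Sum>s\<in>S. ?h {v, v \<otimes> s}) = 2 * first_l2_betti \<Gamma> G"
    unfolding first_l2_betti_def harmonic_def[symmetric]
    by (subst vn_dim_eq[OF harmonic_closed_subspace _ v]) (auto intro: harmonic_act)
  finally show ?thesis unfolding card .
qed

end

theorem corollary4p12:
  fixes \<Gamma> :: "('a, 'c) monoid_scheme"
    and S :: "'a set"
    and G :: "('a, 'a set) pre_digraph"
    and v :: 'a
    and FSF :: "'a set set measure"
  assumes "group \<Gamma>"
    and "infinite (carrier \<Gamma>)"
    and "finite S" and "S \<subseteq> carrier \<Gamma>"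
    and "generate \<Gamma> S = carrier \<Gamma>"
    and "\<And>s. s \<in> S \<Longrightarrow> inv\<^bsub>\<Gamma>\<^esub> s \<in> S"
    and "\<one>\<^bsub>\<Gamma>\<^esub> \<notin> S"
    and "oriented_cayley_graph \<Gamma> S G"
    and "v \<in> verts G"
    and "free_uniform_spanning_forest G FSF"
  shows "(\<integral>F. real (card {e \<in> F. v \<in> e}) \<partial>FSF) = 2 * first_l2_betti \<Gamma> G + 2"
proof -
  interpret cayley_graph \<Gamma> S G
    using assms by (simp add: cayley_graph_def cayley_graph_axioms_def)
  show ?thesis using assms(9,10) unfolding verts_eq by (rule expected_degree)
qed

end
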